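(* Let $1\le p<\infty$, $c\in\mathbb N$, $g$ a weight on $\mathbb Z^c$ satisfying (a)–(e), and $A\in\mathfrak S_{1,g}(\mathbb R^c,\mathfrak S_1)$. Then there exists a measurable function $n:\mathbb R^c\times\mathbb R^c\to\mathbb C$ such that for every $x\in L_p(\mathbb R^c,\mathbb C)$ and almost every $t\in\mathbb R^c$ the integral $\int_{\mathbb R^c}n(t,s)x(s)\,ds$ exists and $(Ax)(t)=\int_{\mathbb R^c}n(t,s)\,x(s)\,ds$.
   Context: Weight conditions on $g:\mathbb Z^c\to(0,\infty)$: (a) $g(0)=1$; (b) $g(m+n)\le g(m)g(n)$; (c) $g(-n)=g(n)$; (d) $g\ge1$; (e) for each $t\in\mathbb Z^c$, $\sqrt[n]{g(nt)}\to1$ as $n\to\infty$. $l_{1,g}(\mathbb Z^c,\mathbb C)$: families $\beta$ with $\sum_m g(m)|\beta_m|<\infty$. Nuclear operators $\mathfrak S_1(Y)$ on a Banach space $Y$: operators $Ay=\sum_i a_i(y)y_i$, $a_i\in Y^*$, $y_i\in Y$, $\sum\|a_i\|\|y_i\|<\infty$, with norm $\|A\|_{\mathfrak S_1}=\inf\sum\|a_i\|\|y_i\|$. $\varphi:L_p(\mathbb R^c,\mathbb C)\to l_p\bigl(\mathbb Z^c,L_p([0,1)^c,\mathbb C)\bigr)$, $\varphi(x)=\{x_m\}$, $x_m(t)=x(t+m)$ for $t\in[0,1)^c$ (an isometric isomorphism). $\mathfrak S_{1,g}(\mathbb R^c,\mathfrak S_1)$ is the set of $A\in\mathcal B(L_p(\mathbb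 R^c,\mathbb C))$ such that $T=\varphi A\varphi^{-1}$ has the form $(Tz)_k=\sum_{m}b_{km}z_{k-m}$ with $b_{km}\in\mathfrak S_1(L_p([0,1)^c,\mathbb C))$, $\|b_{km}\|_{\mathfrak S_1}\le\beta_m$ for some nonnegative $\beta\in l_{1,g}(\mathbb Z^c,\mathbb C)$. *)

theory Defs
  imports "HOL-Analysis.Analysis"
begin

section \<open>L_p spaces (functions modulo a.e. handled by a.e. statements)\<close>

definition memLp :: "real \<Rightarrow> 'a measure \<Rightarrow> ('a \<Rightarrow> complex) \<Rightarrow> bool" where
  "memLp p M f \<longleftrightarrow> f \<in> borel_measurable M \<and> integrable M (\<lambda>x. norm (f x) powr p)"

definition Lpnorm :: "real \<Rightarrow> 'a measure \<Rightarrow> ('a \<Rightarrow> complex) \<Rightarrow> real" where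
  "Lpnorm p M f = (\<integral>x. norm (f x) powr p \<partial>M) powr (1 / p)"

definition Lp_sums :: "real \<Rightarrow> 'a measure \<Rightarrow> (nat \<Rightarrow> 'a \<Rightarrow> complex) \<Rightarrow> ('a \<Rightarrow> complex) \<Rightarrow> bool" where
  "Lp_sums p M f s \<longleftrightarrow> (\<lambda>N. Lpnorm p M (\<lambda>t. s t - (\<Sum>i<N. f i t))) \<longlonglongrightarrow> 0"

definition Lp_has_sum :: "real \<Rightarrow> 'a measure \<Rightarrow> ('i \<Rightarrow> 'a \<Rightarrow> complex) \<Rightarrow> ('a \<Rightarrow> complex) \<Rightarrow> bool" where
  "Lp_has_sum p M f s \<longleftrightarrow>
     ((\<lambda>F. Lpnorm p M (\<lambda>t. s t - (\<Sum>m\<in>F. f m t))) \<longlongrightarrow> 0) (finite_subsets_at_top UNIV)"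

definition bounded_Lp_operator :: "real \<Rightarrow> 'a measure \<Rightarrow> (('a \<Rightarrow> complex) \<Rightarrow> ('a \<Rightarrow> complex)) \<Rightarrow> bool" where
  "bounded_Lp_operator p M A \<longleftrightarrow>
     (\<forall>x. memLp p M x \<longrightarrow> memLp p M (A x)) \<and>
     (\<forall>x y. memLp p M x \<longrightarrow> memLp p M y \<longrightarrow>
        (AE t in M. A (\<lambda>s. x s + y s) t = A x t + A y t)) \<and>
     (\<forall>c x. memLp p M x \<longrightarrow> (AE t in M. A (\<lambda>s. c * x s) t = c * A x t)) \<and>
     (\<exists>C. \<forall>x. memLp p M x \<longrightarrow> Lpnorm p M (A x) \<le> C * Lpnorm p M x)"

definition dual_elem :: "real \<Rightarrow> 'a measure \<Rightarrow> (('a \<Rightarrow> complex) \<Rightarrow> complex) \<Rightarrow> bool" where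
  "dual_elem p M a \<longleftrightarrow>
     (\<forall>x y. memLp p M x \<longrightarrow> memLp p M y \<longrightarrow> a (\<lambda>s. x s + y s) = a x + a y) \<and>
     (\<forall>c x. memLp p M x \<longrightarrow> a (\<lambda>s. c * x s) = c * a x) \<and>
     (\<exists>C. \<forall>x. memLp p M x \<longrightarrow> cmod (a x) \<le> C * Lpnorm p M x)"

definition dual_norm :: "real \<Rightarrow> 'a measure \<Rightarrow> (('a \<Rightarrow> complex) \<Rightarrow> complex) \<Rightarrow> real" where
  "dual_norm p M a = Sup {cmod (a x) | x. memLp p M x \<and> Lpnorm p M x \<le> 1}"

definition nuclear_rep :: "real \<Rightarrow> 'a measure \<Rightarrow> (('a \<Rightarrow> complex) \<Rightarrow> ('a \<Rightarrow> complex))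
     \<Rightarrow> (nat \<Rightarrow> ('a \<Rightarrow> complex) \<Rightarrow> complex) \<Rightarrow> (nat \<Rightarrow> 'a \<Rightarrow> complex) \<Rightarrow> bool" where
  "nuclear_rep p M b a y \<longleftrightarrow>
     (\<forall>i. dual_elem p M (a i)) \<and> (\<forall>i. memLp p M (y i)) \<and>
     summable (\<lambda>i. dual_norm p M (a i) * Lpnorm p M (y i)) \<and>
     (\<forall>z. memLp p M z \<longrightarrow> memLp p M (b z) \<and> Lp_sums p M (\<lambda>i t. a i z * y i t) (b z))"

definition nuclear :: "real \<Rightarrow> 'a measure \<Rightarrow> (('a \<Rightarrow> complex) \<Rightarrow> ('a \<Rightarrow> complex)) \<Rightarrow> bool" where
  "nuclear p M b \<longleftrightarrow> (\<exists>a y. nuclear_rep p M b a y)"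

definition nuclear_norm :: "real \<Rightarrow> 'a measure \<Rightarrow> (('a \<Rightarrow> complex) \<Rightarrow> ('a \<Rightarrow> complex)) \<Rightarrow> real" where
  "nuclear_norm p M b =
     Inf {(\<Sum>i. dual_norm p M (a i) * Lpnorm p M (y i)) | a y. nuclear_rep p M b a y}"

definition ofZ :: "int ^ 'n \<Rightarrow> real ^ 'n" where
  "ofZ k = (\<chi> i. real_of_int (k $ i))"

definition weight :: "(int ^ 'n \<Rightarrow> real) \<Rightarrow> bool" where
  "weight g \<longleftrightarrow>
     g 0 = 1 \<and>
     (\<forall>m n. g (m + n) \<le> g m * g n) \<and>
     (\<forall>n. g (- n) = g n) \<and>
     (\<forall>n. g n \<ge> 1) \<and>
     (\<forall>t. (\<lambda>k. root k (g (of_nat k *s t))) \<longlonglongrightarrow> 1)"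

definition l1g :: "(int ^ 'n \<Rightarrow> real) \<Rightarrow> (int ^ 'n \<Rightarrow> real) \<Rightarrow> bool" where
  "l1g g \<beta> \<longleftrightarrow> (\<lambda>m. g m * norm (\<beta> m)) summable_on UNIV"

definition unit_cube :: "(real ^ 'n) set" where
  "unit_cube = {t. \<forall>i. 0 \<le> t $ i \<and> t $ i < 1}"

text \<open>phi(x)_k (t) = x(t + k), considered as an element of L_p([0,1)^c).\<close>
definition phi :: "(real ^ 'n \<Rightarrow> complex) \<Rightarrow> int ^ 'n \<Rightarrow> real ^ 'n \<Rightarrow> complex" where
  "phi x k = (\<lambda>t. x (t + ofZ k))"

text \<open>The class S_{1,g}(R^c, S_1): T = phi A phi^{-1} has (Tz)_k = sum_m b_km z_{k-m}.\<close>
definition S1g :: "real \<Rightarrow> (int ^ 'n \<Rightarrow> real)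
     \<Rightarrow> ((real ^ 'n \<Rightarrow> complex) \<Rightarrow> (real ^ 'n \<Rightarrow> complex)) \<Rightarrow> bool" where
  "S1g p g A \<longleftrightarrow>
     bounded_Lp_operator p lebesgue A \<and>
     (\<exists>b \<beta>. (\<forall>m. \<beta> m \<ge> 0) \<and> l1g g \<beta> \<and>
        (\<forall>k m. nuclear p (lebesgue_on unit_cube) (b k m) \<and>
               nuclear_norm p (lebesgue_on unit_cube) (b k m) \<le> \<beta> m) \<and>
        (\<forall>x. memLp p lebesgue x \<longrightarrow>
           (\<forall>k. Lp_has_sum p (lebesgue_on unit_cube)
                   (\<lambda>m. b k m (phi x (k - m))) (phi (A x) k))))"

end

theory Submission
  imports Defs
begin

text \<open>
  On the unit cube a bounded functional on L_p is integration against some h, because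
  E \<mapsto> a(indicator E) is an absolutely continuous complex measure; moreover the integral of |h x| is at
  most a constant times the dual norm of a times the L_p norm of x. Hence a nuclear operator
  \<Sum>i. a_i \<otimes> y_i has the kernel \<Sum>i. y_i(t) h_i(s). Almost optimal nuclear representations of
  the b_km have total mass summable in m for each k, so on every cell cube + k the sum over m and i of
  |y_kmi(t)| times the integral of |h_kmi(s) x(s + k - m)| has a finite integral over t and is finite
  for almost every t. This absolute convergence makes the total kernel integrable against x and
  identifies the L_p limit A x with the pointwise sum.
\<close>

section \<open>L_p functions and dominated set functions\<close>

text \<open>Two obstacles shape the argument. The case p = 1 has an endpoint dual, so the density h
  of a functional is never placed in a conjugate space; only the bound on the integral of |h x| is
  kept. It has the same form for all p \<ge> 1 and is exactly what absolute convergence in s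
  requires. In the variable t, L_p membership is used only through integrability over the cube,
  which has finite measure. The second obstacle is the order of quantifiers: the kernel is fixed
  before x, while the null set of bad t depends on x, and integrability against x says nothing about
  points s with x s = 0. Hence the kernel is the \<open>lim\<close> of partial sums along one
  enumeration of all triples (k, m, i). Such a limit is measurable whatever value it takes where the
  sums diverge, and for each x only its product with x s has to be identified, for almost every
  s.\<close>

lemma memLpD:
  assumes "memLp p M x"
  shows "x \<in> borel_measurable M" "integrable M (\<lambda>s. norm (x s) powr p)"
  using assms by (auto simp: memLp_def)

lemma Lpnorm_nonneg [simp]: "0 \<le> Lpnorm p M x"
  by (simp add: Lpnorm_def)

lemma Lpnorm_powr:
  assumes "1 \<le> p"
  shows "Lpnorm p M x powr p = (\<integral>s. norm (x s) powr p \<partial>M)"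
  using assms by (simp add: Lpnorm_def powr_powr)

lemma Lpnorm_mono:
  assumes "1 \<le> p" "memLp p M y" "AE s in M. norm (x s) \<le> norm (y s)"
  shows "Lpnorm p M x \<le> Lpnorm p M y"
  unfolding Lpnorm_def
proof (rule powr_mono2)
  show "(\<integral>s. norm (x s) powr p \<partial>M) \<le> (\<integral>s. norm (y s) powr p \<partial>M)"
    using assms by (intro integral_mono_AE') (auto simp: memLp_def intro!: powr_mono2)
qed (use assms in auto)

lemma memLp_dominated:
  assumes "1 \<le> p" "memLp p M y" "x \<in> borel_measurable M" "AE s in M. norm (x s) \<le> norm (y s)"
  shows "memLp p M x"
  unfolding memLp_def
proof
  show "integrable M (\<lambda>s. norm (x s) powr p)"
    by (rule Bochner_Integration.integrable_bound[OF memLpD(2)[OF assms(2)]])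
       (use assms in \<open>auto intro!: powr_mono2 elim!: eventually_mono\<close>)
qed fact

lemma memLp_scale:
  assumes "1 \<le> p" "memLp p M x"
  shows "memLp p M (\<lambda>s. c * x s)"
  using assms by (auto simp: memLp_def norm_mult powr_mult)

lemma Lpnorm_scale:
  assumes "1 \<le> p"
  shows "Lpnorm p M (\<lambda>s. c * x s) = norm c * Lpnorm p M x"
  using assms by (simp add: Lpnorm_def norm_mult powr_mult powr_powr)

lemma memLp_add:
  assumes p: "1 \<le> p" and x: "memLp p M x" and y: "memLp p M y"
  shows "memLp p M (\<lambda>s. x s + y s)"
  unfolding memLp_def
proof
  note [measurable] = memLpD(1)[OF x] memLpD(1)[OF y]
  show "(\<lambda>s. x s + y s) \<in> borel_measurable M" by measurable
  show "integrable M (\<lambda>s. norm (x s + y s) powr p)"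
  proof (rule Bochner_Integration.integrable_bound)
    show "integrable M (\<lambda>s. 2 powr p * (norm (x s) powr p + norm (y s) powr p))"
      using memLpD(2)[OF x] memLpD(2)[OF y] by simp
    have "norm (x s + y s) powr p \<le> 2 powr p * (norm (x s) powr p + norm (y s) powr p)" for s
    proof -
      have "norm (x s + y s) \<le> 2 * max (norm (x s)) (norm (y s))"
        using norm_triangle_ineq[of "x s" "y s"] by linarith
      then have "norm (x s + y s) powr p \<le> (2 * max (norm (x s)) (norm (y s))) powr p"
        using p by (intro powr_mono2) auto
      also have "\<dots> = 2 powr p * max (norm (x s)) (norm (y s)) powr p"
        by (intro powr_mult)
      also have "\<dots> \<le> 2 powr p * (norm (x s) powr p + norm (y s) powr p)"
        by (intro mult_left_mono) (auto simp: max_def)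
      finally show ?thesis .
    qed
    then show "AE s in M. norm (norm (x s + y s) powr p)
        \<le> norm (2 powr p * (norm (x s) powr p + norm (y s) powr p))"
      by simp
  qed measurable
qed

lemma memLp_diff:
  assumes "1 \<le> p" "memLp p M x" "memLp p M y"
  shows "memLp p M (\<lambda>s. x s - y s)"
  using memLp_add[OF assms(1,2) memLp_scale[OF assms(1,3), of "-1"]] by simp

lemma memLp_zero: "memLp p M (\<lambda>s. 0)"
  by (simp add: memLp_def)

lemma memLp_sum:
  assumes "1 \<le> p" "\<And>i. i \<in> I \<Longrightarrow> memLp p M (x i)"
  shows "memLp p M (\<lambda>s. \<Sum>i\<in>I. x i s)"
  using assms(2)
  by (induction I rule: infinite_finite_induct) (auto simp: memLp_zero intro: memLp_add assms(1))

lemma (in finite_measure) memLp_bounded: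
  assumes "1 \<le> p" "x \<in> borel_measurable M" "\<And>s. s \<in> space M \<Longrightarrow> norm (x s) \<le> B"
  shows "memLp p M x"
proof (rule memLp_dominated)
  show "memLp p M (\<lambda>s. complex_of_real B)" by (simp add: memLp_def)
  have "norm (x s) \<le> norm (complex_of_real B)" if "s \<in> space M" for s
    using assms(3)[OF that] by simp
  then show "AE s in M. norm (x s) \<le> norm (complex_of_real B)" by simp
qed (use assms in auto)

lemma (in finite_measure) memLp_simple_function:
  assumes "1 \<le> p" "simple_function M x"
  shows "memLp p M x"
proof (rule memLp_bounded)
  have "finite (norm ` x ` space M)"
    using assms(2) by (simp add: simple_function_def)
  then show "norm (x s) \<le> Max (norm ` x ` space M)" if "s \<in> space M" for s
    using that by simp
qed (use assms in \<open>auto intro: borel_measurable_simple_function\<close>)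

text \<open>A form of Hoelder's inequality with a crude constant: integrate
  \<open>u \<le> 1 + u powr p\<close> at u = |y| / L, where L is the L_p norm of y. The 1
  contributes the total mass, and the normalised power integrates to 1. Normalising makes the bound
  linear in L and forces the separate case L = 0.\<close>

lemma (in finite_measure) memLp_integrable:
  assumes p: "1 \<le> p" and y: "memLp p M y"
  shows "integrable M y"
    and "(\<integral>s. norm (y s) \<partial>M) \<le> (measure M (space M) + 1) * Lpnorm p M y"
proof -
  note [measurable] = memLpD(1)[OF y]
  have le: "u \<le> 1 + u powr p" if "u \<ge> 0" for u :: real
  proof (cases "u \<le> 1")
    case False
    then have "u powr 1 \<le> u powr p" using p by (intro powr_mono) auto
    then show ?thesis using False by simp
  qed (simp add: add_increasing2)
  show i: "integrable M y"
    by (rule Bochner_Integration.integrable_bound[where f="\<lambda>s. 1 + norm (y s) powr p"])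
       (use memLpD(2)[OF y] le in \<open>auto simp: abs_of_nonneg\<close>)
  define L where "L = Lpnorm p M y"
  show "(\<integral>s. norm (y s) \<partial>M) \<le> (measure M (space M) + 1) * Lpnorm p M y"
  proof (cases "L = 0")
    case True
    then have "(\<integral>s. norm (y s) powr p \<partial>M) = 0"
      using Lpnorm_powr[OF p, of M y] by (simp add: L_def)
    then have "AE s in M. norm (y s) powr p = 0"
      by (subst (asm) integral_nonneg_eq_0_iff_AE) (use memLpD(2)[OF y] in auto)
    then have "AE s in M. norm (y s) = 0" by simp
    then have "(\<integral>s. norm (y s) \<partial>M) = (\<integral>s. 0 \<partial>M)"
      by (intro integral_cong_AE) auto
    then show ?thesis by simp
  next
    case False
    then have L: "L > 0" by (simp add: L_def less_le)
    have "(\<integral>s. norm (y s) / L \<partial>M) \<le> (\<integral>s. 1 + norm (y s) powr p / L powr p \<partial>M)"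
      using i memLpD(2)[OF y] le L
      by (intro integral_mono) (auto simp: powr_divide[symmetric], simp add: powr_divide)
    also have "\<dots> = measure M (space M) + 1"
      using memLpD(2)[OF y] L by (simp add: Lpnorm_powr[OF p, symmetric] L_def)
    finally show ?thesis using L by (simp add: field_simps L_def)
  qed
qed

text \<open>The power bound does two jobs. Along a decreasing sequence with empty intersection it
  forces \<open>\<nu>\<close> to 0, which upgrades finite additivity to countable additivity; on
  null sets it forces \<open>\<nu>\<close> to vanish, which is absolute continuity. Radon-Nikodym
  then applies.\<close>

lemma (in finite_measure) dominated_additive_imp_density:
  assumes nonneg: "\<And>E. E \<in> sets M \<Longrightarrow> 0 \<le> \<nu> E"
    and add: "\<And>E F. E \<in> sets M \<Longrightarrow> F \<in> sets M \<Longrightarrow> E \<inter> F = {} \<Longrightarrow> \<nu> (E \<union> F) = \<nu> E + \<nu> F"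
    and dom: "\<And>E. E \<in> sets M \<Longrightarrow> \<nu> E \<le> C * measure M E powr r"
    and r: "0 < r"
  shows "\<exists>h. integrable M h \<and> (\<forall>E\<in>sets M. \<nu> E = (\<integral>s. indicator E s * h s \<partial>M))"
proof -
  define N where "N = measure_of (space M) (sets M) (\<lambda>E. ennreal (\<nu> E))"
  have [simp]: "sets N = sets M" "space N = space M"
    by (simp_all add: N_def)
  have "\<nu> {} = 0" using add[of "{}" "{}"] by simp
  then have pos: "positive (sets M) (\<lambda>E. ennreal (\<nu> E))"
    by (simp add: positive_def)
  have "countably_additive (sets M) (\<lambda>E. ennreal (\<nu> E))"
  proof (rule sets.empty_continuous_imp_countably_additive[OF pos])
    show "additive (sets M) (\<lambda>E. ennreal (\<nu> E))"
      by (auto simp: additive_def add nonneg)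
    fix A :: "nat \<Rightarrow> 'a set"
    assume A: "range A \<subseteq> sets M" "decseq A" "(\<Inter>i. A i) = {}"
    have "(\<lambda>i. measure M (A i)) \<longlonglongrightarrow> 0"
      using finite_Lim_measure_decseq[OF A(1,2)] A(3) by simp
    then have lim: "(\<lambda>i. C * measure M (A i) powr r) \<longlonglongrightarrow> 0"
      using r by (intro tendsto_mult_right_zero tendsto_zero_powrI[where b=r]) auto
    have "(\<lambda>i. \<nu> (A i)) \<longlonglongrightarrow> 0"
      by (rule tendsto_sandwich[OF _ _ tendsto_const lim])
         (use A(1) in \<open>auto intro!: always_eventually nonneg dom\<close>)
    then show "(\<lambda>i. ennreal (\<nu> (A i))) \<longlonglongrightarrow> 0"
      using tendsto_ennrealI by force
  qed auto
  then have N: "emeasure N E = ennreal (\<nu> E)" if "E \<in> sets M" for E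
    using emeasure_measure_of[OF N_def, of E] pos that
    by (auto simp: sets.space_closed)
  have "finite_measure N"
    by (rule finite_measureI) (simp add: N)
  moreover have "absolutely_continuous M N"
    unfolding absolutely_continuous_def
  proof
    fix E assume "E \<in> null_sets M"
    then have E: "E \<in> sets M" "measure M E = 0" by (auto simp: measure_def)
    then have "\<nu> E = 0" using dom[of E] nonneg[of E] by simp
    then show "E \<in> null_sets N" using E N[of E] by auto
  qed
  ultimately obtain f where f [measurable]: "f \<in> borel_measurable M" and fN: "density M f = N"
    using Radon_Nikodym_finite_measure[of N] by auto
  have fE: "(\<integral>\<^sup>+s. f s * indicator E s \<partial>M) = ennreal (\<nu> E)" if "E \<in> sets M" for E
    using emeasure_density[OF f that] N[OF that] fN by simp
  have "(\<integral>\<^sup>+s. f s \<partial>M) = (\<integral>\<^sup>+s. f s * indicator (space M) s \<partial>M)"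
    by (intro nn_integral_cong) simp
  then have fin: "(\<integral>\<^sup>+s. f s \<partial>M) \<noteq> \<infinity>" using fE[of "space M"] by simp
  then have AE: "AE s in M. f s \<noteq> \<infinity>" by (intro nn_integral_PInf_AE) auto
  define h where "h s = enn2real (f s)" for s
  have [measurable]: "h \<in> borel_measurable M" unfolding h_def by measurable
  have fh: "AE s in M. ennreal (h s) = f s"
    using AE by (auto simp: h_def top.not_eq_extremum less_top)
  have int: "integrable M h"
  proof (rule integrableI_bounded)
    have "(\<integral>\<^sup>+s. ennreal (norm (h s)) \<partial>M) = (\<integral>\<^sup>+s. f s \<partial>M)"
      using fh by (intro nn_integral_cong_AE) (auto simp: h_def)
    then show "(\<integral>\<^sup>+s. ennreal (norm (h s)) \<partial>M) < \<infinity>"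
      using fin by (simp add: less_top[symmetric])
  qed measurable
  have "\<nu> E = (\<integral>s. indicator E s * h s \<partial>M)" if E [measurable]: "E \<in> sets M" for E
  proof -
    have "(\<integral>\<^sup>+s. ennreal (indicator E s * h s) \<partial>M) = (\<integral>\<^sup>+s. f s * indicator E s \<partial>M)"
      using fh by (intro nn_integral_cong_AE) (auto split: split_indicator)
    then have "(\<integral>\<^sup>+s. ennreal (indicator E s * h s) \<partial>M) = ennreal (\<nu> E)" by (simp add: fE E)
    then show ?thesis
      by (subst integral_eq_nn_integral) (auto simp: h_def nonneg E)
  qed
  with int show ?thesis by blast
qed

text \<open>Meant for the real and imaginary parts of a functional evaluated on indicators, which
  have no sign. The exponent r will be 1/p, since the L_p norm of an indicator is the measure to
  that power.\<close>

lemma (in finite_measure) dominated_signed_imp_density: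
  fixes \<nu> :: "'a set \<Rightarrow> real"
  assumes add: "\<And>E F. E \<in> sets M \<Longrightarrow> F \<in> sets M \<Longrightarrow> E \<inter> F = {} \<Longrightarrow> \<nu> (E \<union> F) = \<nu> E + \<nu> F"
    and dom: "\<And>E. E \<in> sets M \<Longrightarrow> \<bar>\<nu> E\<bar> \<le> C * measure M E powr r"
    and r: "0 < r"
  shows "\<exists>h. integrable M h \<and> (\<forall>E\<in>sets M. \<nu> E = (\<integral>s. indicator E s * h s \<partial>M))"
proof -
  \<comment> \<open>The sign of C is not assumed. A negative C is possible only over a null space,
    where the bound is 0 on every set; in both cases the bound is monotone in the set.\<close>
  have "C \<ge> 0 \<or> measure M (space M) = 0"
    using dom[of "space M"] by (cases "measure M (space M) = 0")
      (auto simp: zero_le_mult_iff dest: order_trans[OF abs_ge_zero])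
  then have monoC: "C * measure M F powr r \<le> C * measure M E powr r"
    if "E \<in> sets M" "F \<in> sets M" "F \<subseteq> E" for E F
  proof
    assume "C \<ge> 0"
    then show ?thesis using that r
      by (intro mult_left_mono powr_mono2 finite_measure_mono) auto
  next
    assume "measure M (space M) = 0"
    then have "measure M E = 0" "measure M F = 0"
      using bounded_measure[of E] bounded_measure[of F] by (auto intro: antisym)
    then show ?thesis by simp
  qed
  define S where "S E = \<nu> ` {F \<in> sets M. F \<subseteq> E}" for E
  \<comment> \<open>The positive part of the Jordan decomposition; it inherits the bound by C * measure M E powr r,
      which is what makes it countably additive.\<close>
  define \<nu>p where "\<nu>p E = Sup (S E)" for E
  have S_le: "v \<le> C * measure M E powr r" if "E \<in> sets M" "v \<in> S E" for E v
    using that dom monoC[of E] unfolding S_def by fastforce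
  then have bdd: "bdd_above (S E)" if "E \<in> sets M" for E
    using that by (intro bdd_aboveI) blast
  have ne: "S E \<noteq> {}" for E by (auto simp: S_def)
  have empty: "\<nu> {} = 0" using add[of "{}" "{}"] by simp
  have nonneg: "0 \<le> \<nu>p E" if "E \<in> sets M" for E
    unfolding \<nu>p_def by (rule cSup_upper[OF _ bdd[OF that]])
      (auto simp: S_def image_iff empty intro!: exI[of _ "{}"])
  have ge: "\<nu> E \<le> \<nu>p E" if "E \<in> sets M" for E
    unfolding \<nu>p_def by (rule cSup_upper[OF _ bdd[OF that]]) (use that in \<open>auto simp: S_def\<close>)
  have le: "\<nu>p E \<le> C * measure M E powr r" if "E \<in> sets M" for E
    unfolding \<nu>p_def by (rule cSup_least[OF ne]) (use S_le that in auto)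
  have padd: "\<nu>p (E \<union> F) = \<nu>p E + \<nu>p F"
    if E: "E \<in> sets M" and F: "F \<in> sets M" and EF: "E \<inter> F = {}" for E F
  proof (rule antisym)
    have EF': "E \<union> F \<in> sets M" using E F by auto
    show "\<nu>p (E \<union> F) \<le> \<nu>p E + \<nu>p F"
      unfolding \<nu>p_def[of "E \<union> F"]
    proof (rule cSup_least[OF ne])
      fix v assume "v \<in> S (E \<union> F)"
      then obtain G where G: "G \<in> sets M" "G \<subseteq> E \<union> F" "v = \<nu> G" by (auto simp: S_def)
      have "v = \<nu> ((G \<inter> E) \<union> (G \<inter> F))"
        using G by (metis Int_Un_distrib inf.absorb_iff1)
      also have "\<dots> = \<nu> (G \<inter> E) + \<nu> (G \<inter> F)"
        using E F EF G by (intro add) auto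
      also have "\<dots> \<le> \<nu>p E + \<nu>p F"
        unfolding \<nu>p_def using E F G by (intro add_mono cSup_upper bdd) (auto simp: S_def)
      finally show "v \<le> \<nu>p E + \<nu>p F" .
    qed
    \<comment> \<open>The two suprema are taken one after the other: over v with w fixed, then over
      w.\<close>
    have "v \<le> \<nu>p (E \<union> F) - w" if v: "v \<in> S E" and w: "w \<in> S F" for v w
    proof -
      obtain G H where G: "G \<in> sets M" "G \<subseteq> E" "v = \<nu> G" and H: "H \<in> sets M" "H \<subseteq> F" "w = \<nu> H"
        using v w by (auto simp: S_def)
      have "v + w = \<nu> (G \<union> H)" using G H EF by (subst add) auto
      also have "\<dots> \<le> \<nu>p (E \<union> F)"
        unfolding \<nu>p_def using G H by (intro cSup_upper bdd[OF EF']) (auto simp: S_def)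
      finally show ?thesis by simp
    qed
    then have "\<nu>p E \<le> \<nu>p (E \<union> F) - w" if "w \<in> S F" for w
      unfolding \<nu>p_def[of E] using that by (intro cSup_least[OF ne]) auto
    then have "w \<le> \<nu>p (E \<union> F) - \<nu>p E" if "w \<in> S F" for w
      using that by fastforce
    then have "\<nu>p F \<le> \<nu>p (E \<union> F) - \<nu>p E"
      unfolding \<nu>p_def[of F] by (intro cSup_least[OF ne]) auto
    then show "\<nu>p E + \<nu>p F \<le> \<nu>p (E \<union> F)" by simp
  qed
  have "\<exists>h. integrable M h \<and> (\<forall>E\<in>sets M. \<nu>p E = (\<integral>s. indicator E s * h s \<partial>M))"
    by (rule dominated_additive_imp_density[OF nonneg padd le r])
  then obtain h1 where h1: "integrable M h1"
      "\<And>E. E \<in> sets M \<Longrightarrow> \<nu>p E = (\<integral>s. indicator E s * h1 s \<partial>M)"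
    by blast
  \<comment> \<open>\<open>\<nu>p E - \<nu> E\<close> is the negative part. Its constant 2 * C adds
    the bounds of \<open>\<nu>p\<close> and of |\<open>\<nu>\<close>|.\<close>
  have "\<exists>h. integrable M h \<and> (\<forall>E\<in>sets M. \<nu>p E - \<nu> E = (\<integral>s. indicator E s * h s \<partial>M))"
  proof (rule dominated_additive_imp_density[OF _ _ _ r])
    show "\<nu>p E - \<nu> E \<le> 2 * C * measure M E powr r" if "E \<in> sets M" for E
      using le[OF that] dom[OF that] by linarith
  qed (auto simp: ge padd add)
  then obtain h2 where h2: "integrable M h2"
      "\<And>E. E \<in> sets M \<Longrightarrow> \<nu>p E - \<nu> E = (\<integral>s. indicator E s * h2 s \<partial>M)"
    by blast
  have "\<nu> E = (\<integral>s. indicator E s * (h1 s - h2 s) \<partial>M)" if E: "E \<in> sets M" for E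
  proof -
    have "integrable M (\<lambda>s. indicator E s * h1 s)" "integrable M (\<lambda>s. indicator E s * h2 s)"
      using integrable_mult_indicator[OF E h1(1)] integrable_mult_indicator[OF E h2(1)] by simp_all
    then have "(\<integral>s. indicator E s * (h1 s - h2 s) \<partial>M) = \<nu>p E - (\<nu>p E - \<nu> E)"
      by (simp add: right_diff_distrib h1(2)[OF E, symmetric] h2(2)[OF E, symmetric])
    then show ?thesis by simp
  qed
  then show ?thesis using h1(1) h2(1) by (intro exI[of _ "\<lambda>s. h1 s - h2 s"]) auto
qed

section \<open>The dual of L_p over a finite measure\<close>

lemma dual_elem_zero:
  assumes "dual_elem p M a"
  shows "a (\<lambda>s. 0) = 0"
proof -
  have "a (\<lambda>s. 0 * 0) = 0 * a (\<lambda>s. 0)"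
    using assms memLp_zero unfolding dual_elem_def by blast
  then show ?thesis by simp
qed

lemma dual_elem_sum:
  assumes p: "1 \<le> p" and a: "dual_elem p M a" and x: "\<And>i. i \<in> I \<Longrightarrow> memLp p M (x i)"
  shows "a (\<lambda>s. \<Sum>i\<in>I. x i s) = (\<Sum>i\<in>I. a (x i))"
  using x
proof (induction I rule: infinite_finite_induct)
  case (insert i I)
  then have "memLp p M (x i)" "memLp p M (\<lambda>s. \<Sum>i\<in>I. x i s)"
    by (auto intro: memLp_sum[OF p])
  then show ?case using a insert by (auto simp: dual_elem_def)
qed (auto simp: dual_elem_zero[OF a])

lemma dual_elem_diff:
  assumes p: "1 \<le> p" and a: "dual_elem p M a" and x: "memLp p M x" and y: "memLp p M y"
  shows "a (\<lambda>s. x s - y s) = a x - a y"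
proof -
  have "a (\<lambda>s. x s + (-1) * y s) = a x + (-1) * a y"
    using a x y memLp_scale[OF p y, of "-1"] unfolding dual_elem_def by metis
  then show ?thesis by simp
qed

lemma dual_norm_bdd:
  assumes "dual_elem p M a"
  shows "bdd_above {cmod (a x) | x. memLp p M x \<and> Lpnorm p M x \<le> 1}"
proof -
  obtain C where C: "\<And>x. memLp p M x \<Longrightarrow> cmod (a x) \<le> C * Lpnorm p M x"
    using assms by (auto simp: dual_elem_def)
  have "cmod (a x) \<le> \<bar>C\<bar>" if "memLp p M x" "Lpnorm p M x \<le> 1" for x
  proof -
    have "cmod (a x) \<le> \<bar>C\<bar> * Lpnorm p M x"
      using C[OF that(1)] by (rule order_trans) (auto intro: mult_right_mono)
    also have "\<dots> \<le> \<bar>C\<bar> * 1" using that by (intro mult_left_mono) auto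
    finally show ?thesis by simp
  qed
  then show ?thesis by (auto intro!: bdd_aboveI)
qed

lemma dual_norm_nonneg:
  assumes "dual_elem p M a"
  shows "0 \<le> dual_norm p M a"
  unfolding dual_norm_def
  by (rule cSup_upper2[OF _ _ dual_norm_bdd[OF assms], of "cmod (a (\<lambda>s. 0))"])
     (auto intro!: exI[of _ "\<lambda>s. 0"] simp: memLp_zero Lpnorm_def)

lemma dual_norm_bound:
  assumes p: "1 \<le> p" and a: "dual_elem p M a" and x: "memLp p M x"
  shows "cmod (a x) \<le> dual_norm p M a * Lpnorm p M x"
proof (cases "Lpnorm p M x = 0")
  case True
  \<comment> \<open>Here x cannot be normalised; the boundedness of the functional gives a x = 0
    directly.\<close>
  then show ?thesis using a x unfolding dual_elem_def by fastforce
next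
  case False
  then have L: "Lpnorm p M x > 0" by (simp add: less_le)
  define r where "r = complex_of_real (inverse (Lpnorm p M x))"
  have "cmod (a (\<lambda>s. r * x s)) \<le> dual_norm p M a"
    unfolding dual_norm_def
    by (rule cSup_upper[OF _ dual_norm_bdd[OF a]])
       (use L in \<open>auto intro!: exI[of _ "\<lambda>s. r * x s"] memLp_scale[OF p x]
          simp: Lpnorm_scale[OF p] r_def norm_inverse\<close>)
  moreover have "a (\<lambda>s. r * x s) = r * a x"
    using a x by (auto simp: dual_elem_def)
  ultimately have "inverse (Lpnorm p M x) * cmod (a x) \<le> dual_norm p M a"
    using L by (simp add: norm_mult r_def norm_inverse)
  then show ?thesis using L by (simp add: field_simps)
qed

lemma Lpnorm_tendsto_zero:
  assumes p: "1 \<le> p" and x: "memLp p M x"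
    and u: "\<And>i. u i \<in> borel_measurable M"
    and lim: "AE s in M. (\<lambda>i. u i s) \<longlonglongrightarrow> 0"
    and bnd: "\<And>i. AE s in M. norm (u i s) \<le> norm (x s)"
  shows "(\<lambda>i. Lpnorm p M (u i)) \<longlonglongrightarrow> 0"
proof -
  have "(\<lambda>i. \<integral>s. norm (u i s) powr p \<partial>M) \<longlonglongrightarrow> (\<integral>s. 0 \<partial>M)"
  proof (rule integral_dominated_convergence)
    show "integrable M (\<lambda>s. norm (x s) powr p)" by (rule memLpD(2)[OF x])
    show "AE s in M. (\<lambda>i. norm (u i s) powr p) \<longlonglongrightarrow> 0"
      using lim
    proof eventually_elim
      case (elim s)
      then show ?case using p tendsto_norm_zero[OF elim]
        by (intro tendsto_zero_powrI[where b=p]) auto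
    qed
    show "AE s in M. norm (norm (u i s) powr p) \<le> norm (x s) powr p" for i
      using bnd[of i] p by (auto intro!: powr_mono2 elim!: eventually_mono)
  qed (use u in auto)
  then have "(\<lambda>i. \<integral>s. norm (u i s) powr p \<partial>M) \<longlonglongrightarrow> 0" by simp
  then show ?thesis
    unfolding Lpnorm_def using p
    by (intro tendsto_zero_powrI[where b="1/p"]) auto
qed

text \<open>The factor 4 is 2 times 2: one factor from estimating |h| by |Re h| + |Im h|, each
  tested separately, and one from simple approximants that satisfy only |u_i| \<le> 2 |x|.\<close>

theorem (in finite_measure) Lp_dual_representation:
  assumes p: "1 \<le> p" and a: "dual_elem p M a"
  shows "\<exists>h\<in>borel_measurable M. \<forall>x. memLp p M x \<longrightarrow>
           integrable M (\<lambda>s. h s * x s) \<and> a x = (\<integral>s. h s * x s \<partial>M) \<and>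
           (\<integral>s. norm (h s * x s) \<partial>M) \<le> 4 * dual_norm p M a * Lpnorm p M x"
proof -
  define C where "C = dual_norm p M a"
  have C0: "C \<ge> 0" unfolding C_def by (rule dual_norm_nonneg[OF a])
  have aC: "cmod (a x) \<le> C * Lpnorm p M x" if "memLp p M x" for x
    unfolding C_def by (rule dual_norm_bound[OF p a that])
  have indLp: "memLp p M (indicator E)" if "E \<in> sets M" for E
    by (rule memLp_bounded[OF p, of _ 1]) (use that in \<open>auto split: split_indicator\<close>)
  define \<nu> where "\<nu> E = a (indicator E)" for E
  have add: "\<nu> (E \<union> F) = \<nu> E + \<nu> F" if "E \<in> sets M" "F \<in> sets M" "E \<inter> F = {}" for E F
  proof -
    have "(indicator (E \<union> F) :: 'a \<Rightarrow> complex) = (\<lambda>s. indicator E s + indicator F s)"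
      using that by (auto simp: fun_eq_iff split: split_indicator)
    then show ?thesis
      using a indLp that unfolding \<nu>_def dual_elem_def by auto
  qed
  have dom: "cmod (\<nu> E) \<le> C * measure M E powr (1 / p)" if E: "E \<in> sets M" for E
  proof -
    have "(\<integral>s. norm (indicator E s :: complex) powr p \<partial>M) = (\<integral>s. indicator E s \<partial>M)"
      by (intro Bochner_Integration.integral_cong) (auto split: split_indicator)
    then have "Lpnorm p M (indicator E) = measure M E powr (1 / p)"
      using E by (simp add: Lpnorm_def)
    then show ?thesis using aC[OF indLp[OF E]] by (simp add: \<nu>_def)
  qed
  have "\<exists>h. integrable M h \<and> (\<forall>E\<in>sets M. Re (\<nu> E) = (\<integral>s. indicator E s * h s \<partial>M))"
    by (rule dominated_signed_imp_density[where C=C and r="1/p"])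
       (use add dom p in \<open>auto intro: order_trans[OF abs_Re_le_cmod]\<close>)
  then obtain h1 where h1 [measurable]: "integrable M h1"
      and h1E: "\<And>E. E \<in> sets M \<Longrightarrow> Re (\<nu> E) = (\<integral>s. indicator E s * h1 s \<partial>M)" by blast
  have "\<exists>h. integrable M h \<and> (\<forall>E\<in>sets M. Im (\<nu> E) = (\<integral>s. indicator E s * h s \<partial>M))"
    by (rule dominated_signed_imp_density[where C=C and r="1/p"])
       (use add dom p in \<open>auto intro: order_trans[OF abs_Im_le_cmod]\<close>)
  then obtain h2 where h2 [measurable]: "integrable M h2"
      and h2E: "\<And>E. E \<in> sets M \<Longrightarrow> Im (\<nu> E) = (\<integral>s. indicator E s * h2 s \<partial>M)" by blast
  have [measurable]: "h1 \<in> borel_measurable M" "h2 \<in> borel_measurable M"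
    using h1 h2 by auto
  define h where "h s = Complex (h1 s) (h2 s)" for s
  have h_parts: "Re (h s) = h1 s" "Im (h s) = h2 s" for s by (simp_all add: h_def)
  have h_alt: "h = (\<lambda>s. complex_of_real (h1 s) + \<i> * complex_of_real (h2 s))"
    by (simp add: h_def fun_eq_iff complex_eq_iff)
  have hint: "integrable M h"
    unfolding h_alt using h1 h2
    by (intro Bochner_Integration.integrable_add integrable_mult_right integrable_of_real) auto
  have hm [measurable]: "h \<in> borel_measurable M" using hint by auto
  have hE: "integrable M (\<lambda>s. h s * indicator E s)" "\<nu> E = (\<integral>s. h s * indicator E s \<partial>M)"
    if E: "E \<in> sets M" for E
  proof -
    have "integrable M (\<lambda>s. indicat_real E s *\<^sub>R h s)"
      by (rule integrable_mult_indicator[OF E hint])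
    also have "(\<lambda>s. indicat_real E s *\<^sub>R h s) = (\<lambda>s. h s * indicator E s)"
      by (auto split: split_indicator)
    finally show i: "integrable M (\<lambda>s. h s * indicator E s)" .
    have "Re (\<integral>s. h s * indicator E s \<partial>M) = (\<integral>s. indicator E s * h1 s \<partial>M)"
      by (subst integral_Re[OF i, symmetric], rule Bochner_Integration.integral_cong)
         (auto simp: h_def split: split_indicator)
    moreover have "Im (\<integral>s. h s * indicator E s \<partial>M) = (\<integral>s. indicator E s * h2 s \<partial>M)"
      by (subst integral_Im[OF i, symmetric], rule Bochner_Integration.integral_cong)
         (auto simp: h_def split: split_indicator)
    ultimately show "\<nu> E = (\<integral>s. h s * indicator E s \<partial>M)"
      using h1E[OF E] h2E[OF E] by (simp add: complex_eq_iff)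
  qed
  \<comment> \<open>A functional acts on functions defined on the whole type, not on classes, so
    agreement on \<open>space M\<close> does not give equal arguments. The values agree because the
    difference has norm 0.\<close>
  have null: "a x = a y" if "memLp p M x" "memLp p M y" "\<And>s. s \<in> space M \<Longrightarrow> x s = y s" for x y
  proof -
    have "Lpnorm p M (\<lambda>s. x s - y s) = Lpnorm p M (\<lambda>s. 0)"
      unfolding Lpnorm_def using that(3)
      by (intro arg_cong2[where f="(powr)"] Bochner_Integration.integral_cong) auto
    then show ?thesis
      using aC[OF memLp_diff[OF p that(1,2)]] dual_elem_diff[OF p a that(1,2)]
      by (simp add: Lpnorm_def)
  qed
  have simple: "integrable M (\<lambda>s. h s * u s) \<and> a u = (\<integral>s. h s * u s \<partial>M)"
    if u: "simple_function M u" for u :: "'a \<Rightarrow> complex"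
  proof -
    define E where "E v = u -` {v} \<inter> space M" for v
    have E: "E v \<in> sets M" for v
      unfolding E_def by (rule simple_functionD(2)[OF u])
    have fin: "finite (u ` space M)" by (rule simple_functionD(1)[OF u])
    define w where "w s = (\<Sum>v\<in>u ` space M. v * indicator (E v) s)" for s
    have uw: "u s = w s" if "s \<in> space M" for s
    proof -
      have "w s = (\<Sum>v\<in>u ` space M. if v = u s then v else 0)"
        unfolding w_def using that by (intro sum.cong) (auto simp: E_def split: split_indicator)
      then show ?thesis using that fin by simp
    qed
    have hu: "(\<Sum>v\<in>u ` space M. v * (h s * indicator (E v) s)) = h s * u s" if "s \<in> space M" for s
      unfolding uw[OF that] unfolding w_def sum_distrib_left by (intro sum.cong) auto
    have mw: "memLp p M w"
      unfolding w_def by (intro memLp_sum memLp_scale p indLp E)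
    have "a u = a w"
      using memLp_simple_function[OF p u] mw uw by (rule null)
    also have "\<dots> = (\<Sum>v\<in>u ` space M. a (\<lambda>s. v * indicator (E v) s))"
      unfolding w_def by (intro dual_elem_sum[OF p a] memLp_scale p indLp E)
    also have "\<dots> = (\<Sum>v\<in>u ` space M. v * \<nu> (E v))"
      using a indLp[OF E] unfolding \<nu>_def dual_elem_def by (intro sum.cong) auto
    also have "\<dots> = (\<Sum>v\<in>u ` space M. \<integral>s. v * (h s * indicator (E v) s) \<partial>M)"
      using hE[OF E] by simp
    also have "\<dots> = (\<integral>s. (\<Sum>v\<in>u ` space M. v * (h s * indicator (E v) s)) \<partial>M)"
      using hE(1)[OF E] by (intro Bochner_Integration.integral_sum[symmetric]) auto
    also have "\<dots> = (\<integral>s. h s * u s \<partial>M)"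
      by (intro Bochner_Integration.integral_cong) (auto simp: hu)
    finally have eq: "a u = (\<integral>s. h s * u s \<partial>M)" .
    have "integrable M (\<lambda>s. \<Sum>v\<in>u ` space M. v * (h s * indicator (E v) s))"
      using hE(1)[OF E] by (intro Bochner_Integration.integrable_sum) auto
    also have "?this \<longleftrightarrow> integrable M (\<lambda>s. h s * u s)"
      by (intro Bochner_Integration.integrable_cong)
         (auto simp: hu)
    finally show ?thesis using eq by simp
  qed
  have part: "(\<integral>s. \<bar>k s\<bar> * norm (u s) \<partial>M) \<le> C * Lpnorm p M u"
    if u: "simple_function M u" and k [measurable]: "k \<in> borel_measurable M"
      and kT: "\<And>w. integrable M (\<lambda>s. h s * complex_of_real (w s)) \<Longrightarrow>
        \<bar>\<integral>s. k s * w s \<partial>M\<bar> \<le> cmod (\<integral>s. h s * complex_of_real (w s) \<partial>M)"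
    for u :: "'a \<Rightarrow> complex" and k :: "'a \<Rightarrow> real"
  proof -
    \<comment> \<open>Testing the functional on sgn k * |u| bounds the absolute integral.\<close>
    define w where "w s = sgn (k s) * norm (u s)" for s
    have "simple_function M (\<lambda>s. sgn (k s))"
    proof (rule simple_function_borel_measurable)
      show "(\<lambda>s. sgn (k s)) \<in> borel_measurable M" by measurable
      have "(\<lambda>s. sgn (k s)) ` space M \<subseteq> {-1, 0, 1}" by (auto simp: sgn_if)
      then show "finite ((\<lambda>s. sgn (k s)) ` space M)" by (rule finite_subset) auto
    qed
    then have sw: "simple_function M (\<lambda>s. complex_of_real (w s))"
      unfolding w_def using u by (intro simple_function_compose1[where g="complex_of_real"] simple_function_mult
          simple_function_compose1[where g=norm])
    have "(\<integral>s. \<bar>k s\<bar> * norm (u s) \<partial>M) = (\<integral>s. k s * w s \<partial>M)"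
      by (intro Bochner_Integration.integral_cong) (auto simp: w_def abs_sgn mult.assoc)
    also have "\<dots> \<le> cmod (\<integral>s. h s * complex_of_real (w s) \<partial>M)"
      using simple[OF sw] kT[of w] by auto
    also have "\<dots> = cmod (a (\<lambda>s. complex_of_real (w s)))"
      using simple[OF sw] by simp
    also have "\<dots> \<le> C * Lpnorm p M (\<lambda>s. complex_of_real (w s))"
      by (rule aC[OF memLp_simple_function[OF p sw]])
    also have "\<dots> \<le> C * Lpnorm p M u"
      by (intro mult_left_mono Lpnorm_mono p C0 memLp_simple_function u)
         (auto simp: w_def abs_mult sgn_if)
    finally show ?thesis .
  qed
  have simple_bound: "(\<integral>s. norm (h s * u s) \<partial>M) \<le> 2 * C * Lpnorm p M u"
    if u: "simple_function M u" for u :: "'a \<Rightarrow> complex"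
  proof -
    have int: "integrable M (\<lambda>s. norm (h s * u s))" using simple[OF u] by simp
    have um [measurable]: "u \<in> borel_measurable M" using u by (rule borel_measurable_simple_function)
    have i1: "integrable M (\<lambda>s. \<bar>h1 s\<bar> * norm (u s))" "integrable M (\<lambda>s. \<bar>h2 s\<bar> * norm (u s))"
      using abs_Re_le_cmod[of "h _"] abs_Im_le_cmod[of "h _"]
      by (auto intro!: Bochner_Integration.integrable_bound[OF int] AE_I2 mult_right_mono
          simp: norm_mult abs_mult h_def)
    have "(\<integral>s. norm (h s * u s) \<partial>M) \<le> (\<integral>s. \<bar>h1 s\<bar> * norm (u s) + \<bar>h2 s\<bar> * norm (u s) \<partial>M)"
    proof (rule integral_mono[OF int])
      show "integrable M (\<lambda>s. \<bar>h1 s\<bar> * norm (u s) + \<bar>h2 s\<bar> * norm (u s))" using i1 by simp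
      show "norm (h s * u s) \<le> \<bar>h1 s\<bar> * norm (u s) + \<bar>h2 s\<bar> * norm (u s)" for s
        using mult_right_mono[OF cmod_le[of "h s"] norm_ge_zero[of "u s"]]
        by (simp add: norm_mult h_def distrib_right)
    qed
    also have "\<dots> = (\<integral>s. \<bar>h1 s\<bar> * norm (u s) \<partial>M) + (\<integral>s. \<bar>h2 s\<bar> * norm (u s) \<partial>M)"
      using i1 by simp
    also have "\<dots> \<le> C * Lpnorm p M u + C * Lpnorm p M u"
    proof (intro add_mono part u)
      fix w assume i: "integrable M (\<lambda>s. h s * complex_of_real (w s))"
      show "\<bar>\<integral>s. h1 s * w s \<partial>M\<bar> \<le> cmod (\<integral>s. h s * complex_of_real (w s) \<partial>M)"
        using abs_Re_le_cmod[of "\<integral>s. h s * complex_of_real (w s) \<partial>M"]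
        by (simp add: integral_Re[OF i, symmetric] h_parts)
      show "\<bar>\<integral>s. h2 s * w s \<partial>M\<bar> \<le> cmod (\<integral>s. h s * complex_of_real (w s) \<partial>M)"
        using abs_Im_le_cmod[of "\<integral>s. h s * complex_of_real (w s) \<partial>M"]
        by (simp add: integral_Im[OF i, symmetric] h_parts)
    qed measurable
    finally show ?thesis by simp
  qed
  have "integrable M (\<lambda>s. h s * x s) \<and> a x = (\<integral>s. h s * x s \<partial>M) \<and>
           (\<integral>s. norm (h s * x s) \<partial>M) \<le> 4 * C * Lpnorm p M x" if x: "memLp p M x" for x
  proof -
    note [measurable] = memLpD(1)[OF x]
    obtain u where u: "\<And>i. simple_function M (u i)"
        and ux: "\<And>s. s \<in> space M \<Longrightarrow> (\<lambda>i. u i s) \<longlonglongrightarrow> x s"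
        and ub: "\<And>i s. s \<in> space M \<Longrightarrow> norm (u i s) \<le> 2 * norm (x s)"
      using borel_measurable_implies_sequence_metric[OF memLpD(1)[OF x], of 0] by simp metis
    have um [measurable]: "u i \<in> borel_measurable M" for i
      using u by (rule borel_measurable_simple_function)
    have uLp: "memLp p M (u i)" for i by (rule memLp_simple_function[OF p u])
    have uL: "Lpnorm p M (u i) \<le> 2 * Lpnorm p M x" for i
    proof -
      have "Lpnorm p M (u i) \<le> Lpnorm p M (\<lambda>s. 2 * x s)"
        by (rule Lpnorm_mono[OF p memLp_scale[OF p x]]) (use ub in \<open>auto simp: norm_mult\<close>)
      then show ?thesis by (simp add: Lpnorm_scale[OF p])
    qed
    \<comment> \<open>Fatou must come first: it yields integrability of h x from the uniform bound
      on the approximants, and h x then serves as the majorant for dominated convergence.\<close>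
    have nn_le: "(\<integral>\<^sup>+s. norm (h s * x s) \<partial>M) \<le> ennreal (4 * C * Lpnorm p M x)"
    proof -
      have "(\<integral>\<^sup>+s. norm (h s * x s) \<partial>M) = (\<integral>\<^sup>+s. liminf (\<lambda>i. ennreal (norm (h s * u i s))) \<partial>M)"
      proof (rule nn_integral_cong)
        fix s assume "s \<in> space M"
        then have "(\<lambda>i. ennreal (norm (h s * u i s))) \<longlonglongrightarrow> ennreal (norm (h s * x s))"
          by (intro tendsto_ennrealI tendsto_intros ux)
        then show "ennreal (norm (h s * x s)) = liminf (\<lambda>i. ennreal (norm (h s * u i s)))"
          by (intro lim_imp_Liminf[symmetric]) auto
      qed
      also have "\<dots> \<le> liminf (\<lambda>i. \<integral>\<^sup>+s. norm (h s * u i s) \<partial>M)"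
        by (rule nn_integral_liminf) measurable
      also have "\<dots> \<le> liminf (\<lambda>i. ennreal (4 * C * Lpnorm p M x))"
      proof (intro Liminf_mono always_eventually allI)
        fix i
        have "(\<integral>s. norm (h s * u i s) \<partial>M) \<le> 2 * C * Lpnorm p M (u i)" by (rule simple_bound[OF u])
        also have "\<dots> \<le> 2 * C * (2 * Lpnorm p M x)"
          using uL C0 by (intro mult_left_mono) auto
        finally have "(\<integral>s. norm (h s * u i s) \<partial>M) \<le> 4 * C * Lpnorm p M x" by simp
        moreover have "(\<integral>\<^sup>+s. norm (h s * u i s) \<partial>M) = ennreal (\<integral>s. norm (h s * u i s) \<partial>M)"
          using simple[OF u[of i]] by (intro nn_integral_eq_integral) auto
        ultimately show "(\<integral>\<^sup>+s. norm (h s * u i s) \<partial>M) \<le> ennreal (4 * C * Lpnorm p M x)"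
          by (simp add: ennreal_leI)
      qed
      finally show ?thesis by (simp add: Liminf_const)
    qed
    have int: "integrable M (\<lambda>s. h s * x s)"
      using nn_le by (intro integrableI_bounded) (auto intro: le_less_trans)
    have bound: "(\<integral>s. norm (h s * x s) \<partial>M) \<le> 4 * C * Lpnorm p M x"
    proof -
      have "ennreal (\<integral>s. norm (h s * x s) \<partial>M) \<le> ennreal (4 * C * Lpnorm p M x)"
        using nn_integral_eq_integral[OF integrable_norm[OF int]] nn_le by simp
      then show ?thesis using C0 by (simp add: ennreal_le_iff)
    qed
    have "(\<lambda>i. \<integral>s. h s * u i s \<partial>M) \<longlonglongrightarrow> (\<integral>s. h s * x s \<partial>M)"
    proof (rule integral_dominated_convergence)
      show "integrable M (\<lambda>s. 2 * norm (h s * x s))" using int by simp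
      show "AE s in M. (\<lambda>i. h s * u i s) \<longlonglongrightarrow> h s * x s"
        using ux by (intro AE_I2 tendsto_intros) auto
      show "AE s in M. norm (h s * u i s) \<le> 2 * norm (h s * x s)" for i
        using mult_left_mono[OF ub norm_ge_zero[of "h _"]] by (auto simp: norm_mult mult_ac)
    qed measurable
    then have l1: "(\<lambda>i. a (u i)) \<longlonglongrightarrow> (\<integral>s. h s * x s \<partial>M)"
      using simple[OF u] by simp
    have "(\<lambda>i. Lpnorm p M (\<lambda>s. u i s - x s)) \<longlonglongrightarrow> 0"
    \<comment> \<open>The majorant 3 |x| comes from |u_i| + |x| with |u_i| \<le> 2 |x|.\<close>
    proof (rule Lpnorm_tendsto_zero[OF p memLp_scale[OF p x, of 3]])
      show "AE s in M. (\<lambda>i. u i s - x s) \<longlonglongrightarrow> 0"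
        using ux by (intro AE_I2) (auto simp: LIM_zero_iff)
      show "AE s in M. norm (u i s - x s) \<le> norm (3 * x s)" for i
      proof (rule AE_I2)
        fix s assume "s \<in> space M"
        then show "norm (u i s - x s) \<le> norm (3 * x s)"
          using ub[of s i] norm_triangle_ineq4[of "u i s" "x s"] by (simp add: norm_mult)
      qed
    qed measurable
    then have l2: "(\<lambda>i. C * Lpnorm p M (\<lambda>s. u i s - x s)) \<longlonglongrightarrow> 0"
      by (rule tendsto_mult_right_zero)
    have "(\<lambda>i. a (u i) - a x) \<longlonglongrightarrow> 0"
    proof (rule Lim_null_comparison[OF _ l2], intro always_eventually allI)
      show "norm (a (u i) - a x) \<le> C * Lpnorm p M (\<lambda>s. u i s - x s)" for i
        using aC[OF memLp_diff[OF p uLp x]] dual_elem_diff[OF p a uLp x] by simp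
    qed
    then have "(\<lambda>i. a (u i)) \<longlonglongrightarrow> a x" by (simp add: LIM_zero_iff)
    then have "a x = (\<integral>s. h s * x s \<partial>M)" using l1 by (rule LIMSEQ_unique)
    with int bound show ?thesis by blast
  qed
  then show ?thesis using hm unfolding C_def by blast
qed

section \<open>Series of functions over a countable index\<close>

text \<open>Norm convergence gives almost everywhere convergence only along a subsequence. That
  suffices, since the pointwise limit along the subsequence must still be u.\<close>

lemma tendsto_Lpnorm_imp_AE_eq:
  assumes p: "1 \<le> p" and s: "memLp p M s" and f: "\<And>N. memLp p M (f N)"
    and lim: "(\<lambda>N. Lpnorm p M (\<lambda>t. s t - f N t)) \<longlonglongrightarrow> 0"
    and AE: "AE t in M. (\<lambda>N. f N t) \<longlonglongrightarrow> u t"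
  shows "AE t in M. s t = u t"
proof -
  define w where "w N t = norm (s t - f N t) powr p" for N t
  have w: "integrable M (w N)" for N
    unfolding w_def by (rule memLpD(2)[OF memLp_diff[OF p s f]])
  have "(\<lambda>N. Lpnorm p M (\<lambda>t. s t - f N t) powr p) \<longlonglongrightarrow> 0"
    using lim p by (intro tendsto_zero_powrI[where b=p]) auto
  then have "(\<lambda>N. \<integral>t. norm (w N t) \<partial>M) \<longlonglongrightarrow> 0"
    by (simp add: Lpnorm_powr[OF p] w_def)
  then obtain r where r: "strict_mono r" and wr: "AE t in M. (\<lambda>N. w (r N) t) \<longlonglongrightarrow> 0"
    using tendsto_L1_AE_subseq[of M w, OF w] by blast
  show ?thesis
    using AE wr
  proof eventually_elim
    case (elim t)
    have "(\<lambda>N. f (r N) t) \<longlonglongrightarrow> u t"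
      using LIMSEQ_subseq_LIMSEQ[OF elim(1) r] by (simp add: o_def)
    then have "(\<lambda>N. w (r N) t) \<longlonglongrightarrow> norm (s t - u t) powr p"
      unfolding w_def using p by (intro tendsto_powr2 tendsto_intros) auto
    then have "norm (s t - u t) powr p = 0" using elim(2) by (rule LIMSEQ_unique)
    then show ?case by simp
  qed
qed

text \<open>A cofinal sequence of finite sets: it turns limits over the net of all finite subsets
  into sequential limits, for which \<open>lim\<close> is measurable and dominated convergence is
  available.\<close>

definition exhaustion :: "nat \<Rightarrow> 'i::countable set" where
  "exhaustion N = {j. to_nat j < N}"

lemma finite_exhaustion [simp]: "finite (exhaustion N)"
  unfolding exhaustion_def
  by (rule inj_on_finite[of to_nat _ "{..<N}"]) (auto intro: inj_on_subset[OF inj_to_nat])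

lemma filterlim_exhaustion:
  "filterlim exhaustion (finite_subsets_at_top (UNIV :: 'i::countable set)) sequentially"
  unfolding filterlim_finite_subsets_at_top
proof (intro allI impI)
  fix X :: "'i set" assume "finite X \<and> X \<subseteq> UNIV"
  then have X: "finite (to_nat ` X)" by simp
  have "X \<subseteq> exhaustion N" if "N > Max (insert 0 (to_nat ` X))" for N
    using that X by (auto simp: exhaustion_def)
  then show "\<forall>\<^sub>F N in sequentially. finite (exhaustion N) \<and> X \<subseteq> exhaustion N \<and> exhaustion N \<subseteq> (UNIV :: 'i set)"
    by (intro eventually_mono[OF eventually_gt_at_top[of "Max (insert 0 (to_nat ` X))"]]) auto
qed

lemma infsum_exhaustion:
  fixes f :: "'i::countable \<Rightarrow> 'b::banach"
  assumes "(\<lambda>j. norm (f j)) summable_on UNIV"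
  shows "(\<lambda>N. \<Sum>j\<in>exhaustion N. f j) \<longlonglongrightarrow> (\<Sum>\<^sub>\<infinity>j. f j)"
proof -
  have "(f has_sum (\<Sum>\<^sub>\<infinity>j. f j)) UNIV"
    using abs_summable_summable[OF assms] by (rule has_sum_infsum)
  then show ?thesis
    unfolding has_sum_def using filterlim_compose[OF _ filterlim_exhaustion] by auto
qed

lemma summable_on_imp_nn_integral_count_space_finite:
  fixes f :: "'i \<Rightarrow> real"
  assumes "f summable_on UNIV" "\<And>j. 0 \<le> f j"
  shows "(\<integral>\<^sup>+j. ennreal (f j) \<partial>count_space UNIV) < \<infinity>"
proof -
  have "integrable (count_space UNIV) f"
    using assms abs_summable_equivalent[of f UNIV] by (simp add: abs_summable_on_def)
  then show ?thesis using assms(2) by (simp add: integrable_iff_bounded)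
qed

lemma nn_integral_count_space_finite_imp_summable_on:
  fixes f :: "'i \<Rightarrow> real"
  assumes "(\<integral>\<^sup>+j. ennreal (f j) \<partial>count_space UNIV) < \<infinity>" "\<And>j. 0 \<le> f j"
  shows "f summable_on UNIV"
proof -
  have "integrable (count_space UNIV) f"
    using assms by (simp add: integrable_iff_bounded)
  then show ?thesis
    using assms(2) abs_summable_equivalent[of f UNIV] by (simp add: abs_summable_on_def)
qed

text \<open>Tonelli for M and counting measure. The second conclusion later makes the sum of norms
  an integrable majorant of all partial sums.\<close>

lemma AE_norm_summable_on:
  fixes f :: "'i::countable \<Rightarrow> 'a \<Rightarrow> 'b::{banach, second_countable_topology}"
  assumes int: "\<And>j. integrable M (f j)"
    and sum: "(\<lambda>j. \<integral>t. norm (f j t) \<partial>M) summable_on UNIV"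
  shows "AE t in M. (\<lambda>j. norm (f j t)) summable_on UNIV"
    and "(\<integral>\<^sup>+t. (\<integral>\<^sup>+j. ennreal (norm (f j t)) \<partial>count_space UNIV) \<partial>M) < \<infinity>"
proof -
  have [measurable]: "f j \<in> borel_measurable M" for j using int[of j] by auto
  have "(\<integral>\<^sup>+t. (\<integral>\<^sup>+j. ennreal (norm (f j t)) \<partial>count_space UNIV) \<partial>M)
      = (\<integral>\<^sup>+j. (\<integral>\<^sup>+t. ennreal (norm (f j t)) \<partial>M) \<partial>count_space UNIV)"
    by (rule nn_integral_count_space_nn_integral) auto
  also have "\<dots> = (\<integral>\<^sup>+j. ennreal (\<integral>t. norm (f j t) \<partial>M) \<partial>count_space UNIV)"
    using int by (intro nn_integral_cong nn_integral_eq_integral) auto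
  also have "\<dots> < \<infinity>"
    by (rule summable_on_imp_nn_integral_count_space_finite[OF sum]) simp
  finally show fin: "(\<integral>\<^sup>+t. (\<integral>\<^sup>+j. ennreal (norm (f j t)) \<partial>count_space UNIV) \<partial>M) < \<infinity>" .
  have "(\<lambda>t. \<integral>\<^sup>+j. ennreal (norm (f j t)) \<partial>count_space UNIV) \<in> borel_measurable M"
  proof -
    interpret sigma_finite_measure "count_space (UNIV :: 'i set)"
      by (rule sigma_finite_measure_count_space)
    have "(\<lambda>(t, j). ennreal (norm (f j t))) \<in> borel_measurable (M \<Otimes>\<^sub>M count_space UNIV)"
      unfolding case_prod_beta'
      by (rule measurable_compose_countable'[where f="\<lambda>j x. ennreal (norm (f j (fst x)))" and g=snd
            and I=UNIV]) auto
    then show ?thesis by (rule borel_measurable_nn_integral)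
  qed
  then have "AE t in M. (\<integral>\<^sup>+j. ennreal (norm (f j t)) \<partial>count_space UNIV) \<noteq> \<infinity>"
    using fin by (intro nn_integral_PInf_AE) auto
  then show "AE t in M. (\<lambda>j. norm (f j t)) summable_on UNIV"
    by eventually_elim
      (auto intro!: nn_integral_count_space_finite_imp_summable_on simp: top.not_eq_extremum less_top)
qed

text \<open>Termwise integration, phrased with \<open>lim\<close> instead of an infinite sum so that
  the integrand is measurable at once, including on the null set where the series need not converge
  absolutely.\<close>

lemma has_bochner_integral_lim_exhaustion:
  fixes f :: "'i::countable \<Rightarrow> 'a \<Rightarrow> complex"
  assumes int: "\<And>j. integrable M (f j)"
    and sum: "(\<lambda>j. \<integral>t. norm (f j t) \<partial>M) summable_on UNIV"
  shows "has_bochner_integral M (\<lambda>t. lim (\<lambda>N. \<Sum>j\<in>exhaustion N. f j t)) (\<Sum>\<^sub>\<infinity>j. \<integral>t. f j t \<partial>M)"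
proof -
  have [measurable]: "f j \<in> borel_measurable M" for j using int[of j] by auto
  note AE = AE_norm_summable_on(1)[OF int sum]
  define D where "D t = (\<Sum>\<^sub>\<infinity>j. norm (f j t))" for t
  \<comment> \<open>A measurable version of D, equal to it almost everywhere; it is the majorant for
    dominated convergence.\<close>
  define D' where "D' t = lim (\<lambda>N. \<Sum>j\<in>exhaustion N. norm (f j t))" for t
  have D'm [measurable]: "D' \<in> borel_measurable M" unfolding D'_def by measurable
  have DD': "AE t in M. D' t = D t"
    using AE
    by eventually_elim (auto simp: D_def D'_def intro!: limI infsum_exhaustion)
  have D'int: "integrable M D'"
  proof (rule integrableI_bounded)
    have "(\<integral>\<^sup>+t. ennreal (norm (D' t)) \<partial>M)
        = (\<integral>\<^sup>+t. (\<integral>\<^sup>+j. ennreal (norm (f j t)) \<partial>count_space UNIV) \<partial>M)"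
    proof (rule nn_integral_cong_AE)
      show "AE t in M. ennreal (norm (D' t)) = (\<integral>\<^sup>+j. ennreal (norm (f j t)) \<partial>count_space UNIV)"
        using AE DD'
      proof eventually_elim
        case (elim t)
        have "Infinite_Set_Sum.abs_summable_on (\<lambda>j. norm (f j t)) UNIV"
          using elim(1) abs_summable_equivalent[of "\<lambda>j. norm (f j t)" UNIV] by simp
        then have "(\<integral>\<^sup>+j. ennreal (norm (f j t)) \<partial>count_space UNIV) = ennreal (D t)"
          by (simp add: nn_integral_conv_infsetsum infsetsum_infsum D_def)
        then show ?case using elim(2) by (simp add: D_def infsum_nonneg)
      qed
    qed
    then show "(\<integral>\<^sup>+t. ennreal (norm (D' t)) \<partial>M) < \<infinity>"
      using AE_norm_summable_on(2)[OF int sum] by simp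
  qed measurable
  let ?S = "\<lambda>N t. \<Sum>j\<in>exhaustion N. f j t"
  have conv: "AE t in M. (\<lambda>N. ?S N t) \<longlonglongrightarrow> lim (\<lambda>N. ?S N t)"
    using AE
  proof eventually_elim
    case (elim t)
    show ?case using infsum_exhaustion[OF elim] by (metis limI)
  qed
  have dom: "AE t in M. norm (?S N t) \<le> D' t" for N
    using AE DD'
  proof eventually_elim
    case (elim t)
    have "norm (?S N t) \<le> (\<Sum>j\<in>exhaustion N. norm (f j t))" by (rule norm_sum)
    also have "\<dots> \<le> D t"
      unfolding D_def using elim(1) by (intro finite_sum_le_infsum) auto
    finally show ?case using elim(2) by simp
  qed
  have m [measurable]: "(\<lambda>t. lim (\<lambda>N. ?S N t)) \<in> borel_measurable M" "?S N \<in> borel_measurable M" for N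
    by measurable
  have I: "integrable M (\<lambda>t. lim (\<lambda>N. ?S N t))"
    by (rule integrable_dominated_convergence[OF m(1) m(2) D'int conv dom])
  have L: "(\<lambda>N. \<integral>t. ?S N t \<partial>M) \<longlonglongrightarrow> (\<integral>t. lim (\<lambda>N. ?S N t) \<partial>M)"
    by (rule integral_dominated_convergence[OF m(1) m(2) D'int conv dom])
  have sum': "(\<lambda>j. norm (\<integral>t. f j t \<partial>M)) summable_on UNIV"
    by (rule summable_on_comparison_test[OF sum]) auto
  have "(\<lambda>N. \<integral>t. ?S N t \<partial>M) \<longlonglongrightarrow> (\<Sum>\<^sub>\<infinity>j. \<integral>t. f j t \<partial>M)"
    using infsum_exhaustion[OF sum'] int by (simp add: Bochner_Integration.integral_sum)
  with L have "(\<integral>t. lim (\<lambda>N. ?S N t) \<partial>M) = (\<Sum>\<^sub>\<infinity>j. \<integral>t. f j t \<partial>M)"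
    by (rule LIMSEQ_unique)
  with I show ?thesis by (simp add: has_bochner_integral_iff)
qed

section \<open>Translates of the unit cube\<close>

lemma
  fixes c :: "'a::euclidean_space"
  shows measurable_lebesgue_translation: "(\<lambda>t. t + c) \<in> lebesgue \<rightarrow>\<^sub>M lebesgue"
    and distr_lebesgue_translation: "distr lebesgue lebesgue (\<lambda>t. t + c) = lebesgue"
proof -
  have T: "(\<lambda>x. c + (\<Sum>j\<in>Basis. (1 * (x \<bullet> j)) *\<^sub>R j)) = (\<lambda>t. t + c)"
    by (simp add: euclidean_representation add.commute)
  show "(\<lambda>t. t + c) \<in> lebesgue \<rightarrow>\<^sub>M lebesgue"
    using lebesgue_affine_measurable[of "\<lambda>_. 1" c] unfolding T by simp
  show "distr lebesgue lebesgue (\<lambda>t. t + c) = lebesgue"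
    using lebesgue_affine_euclidean[of "\<lambda>_. 1" c] unfolding T by (simp add: density_1)
qed

lemma has_bochner_integral_lebesgue_translation:
  fixes c :: "'a::euclidean_space" and f :: "'a \<Rightarrow> 'b::{banach, second_countable_topology}"
  assumes "has_bochner_integral lebesgue f v"
  shows "has_bochner_integral lebesgue (\<lambda>t. f (t + c)) v"
proof -
  have f: "integrable lebesgue f" "integral\<^sup>L lebesgue f = v" "f \<in> borel_measurable lebesgue"
    using assms by (auto simp: has_bochner_integral_iff)
  have "integrable (distr lebesgue lebesgue (\<lambda>t. t + c)) f"
    using f by (simp add: distr_lebesgue_translation)
  then have "integrable lebesgue (\<lambda>t. f (t + c))"
    by (rule integrable_distr[OF measurable_lebesgue_translation])
  moreover have "integral\<^sup>L lebesgue (\<lambda>t. f (t + c)) = v"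
    using integral_distr[OF measurable_lebesgue_translation f(3), of c] f(2)
    by (simp add: distr_lebesgue_translation)
  ultimately show ?thesis by (simp add: has_bochner_integral_iff)
qed

lemma AE_lebesgue_translation:
  fixes c :: "'a::euclidean_space"
  assumes "AE t in lebesgue. P t"
  shows "AE t in lebesgue. P (t + c)"
  by (rule AE_distrD[OF measurable_lebesgue_translation])
     (subst distr_lebesgue_translation, rule assms)

lemma unit_cube_sets [measurable]: "unit_cube \<in> sets (lebesgue :: (real^'n::finite) measure)"
proof -
  have "unit_cube = (\<Inter>i. {t :: real^'n. 0 \<le> t $ i} \<inter> {t. t $ i < 1})"
    by (auto simp: unit_cube_def)
  also have "\<dots> \<in> sets borel"
    by (intro sets.countable_INT'' sets.Int borel_closed borel_open
        closed_Collect_le open_Collect_less continuous_intros) auto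
  finally show ?thesis using sets_completionI_sets[of unit_cube lborel] by simp
qed

lemma finite_measure_unit_cube: "finite_measure (lebesgue_on (unit_cube :: (real^'n::finite) set))"
proof (rule finite_measure_lebesgue_on, rule bounded_set_imp_lmeasurable)
  have "unit_cube \<subseteq> cbox (0 :: real^'n) 1"
    by (auto simp: unit_cube_def mem_box_cart less_imp_le)
  then show "bounded (unit_cube :: (real^'n) set)"
    using bounded_cbox bounded_subset by blast
qed (rule unit_cube_sets)

lemma unit_cube_cell_exists: "\<exists>k. t - ofZ k \<in> unit_cube"
  by (rule exI[of _ "\<chi> i. \<lfloor>t $ i\<rfloor>"]) (simp add: unit_cube_def ofZ_def, linarith)

lemma unit_cube_cell_unique:
  assumes "t - ofZ k \<in> unit_cube" "t - ofZ l \<in> unit_cube"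
  shows "k = l"
proof -
  have "k $ i = l $ i" for i
  proof -
    have "0 \<le> t $ i - real_of_int (k $ i)" "t $ i - real_of_int (k $ i) < 1"
         "0 \<le> t $ i - real_of_int (l $ i)" "t $ i - real_of_int (l $ i) < 1"
      using assms by (auto simp: unit_cube_def ofZ_def)
    then show ?thesis by linarith
  qed
  then show ?thesis by (simp add: vec_eq_iff)
qed

text \<open>This is the inverse of \<open>phi\<close> on families concentrated in the single
  coordinate k. The value type is general because both complex products and their real norms are
  moved to cells.\<close>

definition cell :: "int ^ 'n \<Rightarrow> (real ^ 'n \<Rightarrow> 'b::zero) \<Rightarrow> real ^ 'n \<Rightarrow> 'b" where
  "cell k f t = (if t - ofZ k \<in> unit_cube then f (t - ofZ k) else 0)"

lemma borel_measurable_cell: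
  fixes f :: "real ^ 'n::finite \<Rightarrow> complex"
  assumes "f \<in> borel_measurable (lebesgue_on unit_cube)"
  shows "cell k f \<in> borel_measurable lebesgue"
proof -
  have "(\<lambda>t. indicator unit_cube t *\<^sub>R f t) \<in> borel_measurable lebesgue"
    using assms unit_cube_sets by (subst (asm) borel_measurable_restrict_space_iff) auto
  from measurable_compose[OF measurable_lebesgue_translation[of "- ofZ k"] this]
  have "(\<lambda>t. indicator unit_cube (t - ofZ k) *\<^sub>R f (t - ofZ k)) \<in> borel_measurable lebesgue"
    by simp
  also have "(\<lambda>t. indicator unit_cube (t - ofZ k) *\<^sub>R f (t - ofZ k)) = cell k f"
    by (auto simp: cell_def)
  finally show ?thesis .
qed

lemma has_bochner_integral_cell:
  fixes f :: "real ^ 'n::finite \<Rightarrow> 'b::{banach, second_countable_topology}"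
  assumes "integrable (lebesgue_on unit_cube) f"
  shows "has_bochner_integral lebesgue (cell k f) (integral\<^sup>L (lebesgue_on unit_cube) f)"
proof -
  have "has_bochner_integral lebesgue (\<lambda>t. indicator unit_cube t *\<^sub>R f t)
      (integral\<^sup>L (lebesgue_on unit_cube) f)"
    using assms unit_cube_sets
    by (subst has_bochner_integral_restrict_space[symmetric]) (auto simp: has_bochner_integral_iff)
  from has_bochner_integral_lebesgue_translation[OF this, of "- ofZ k"]
  have "has_bochner_integral lebesgue (\<lambda>t. indicator unit_cube (t - ofZ k) *\<^sub>R f (t - ofZ k))
      (integral\<^sup>L (lebesgue_on unit_cube) f)"
    by simp
  also have "(\<lambda>t. indicator unit_cube (t - ofZ k) *\<^sub>R f (t - ofZ k)) = cell k f"
    by (auto simp: cell_def)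
  finally show ?thesis .
qed

text \<open>There are countably many cells, so the translated exceptional sets together form one
  null set.\<close>

lemma AE_lebesgue_cells:
  fixes P :: "int ^ 'n::finite \<Rightarrow> real ^ 'n \<Rightarrow> bool"
  assumes "\<And>k. AE t in lebesgue_on unit_cube. P k t"
  shows "AE t in lebesgue. \<forall>k. t - ofZ k \<in> unit_cube \<longrightarrow> P k (t - ofZ k)"
proof (subst AE_all_countable, rule allI)
  fix k
  have "AE t in lebesgue. t \<in> unit_cube \<longrightarrow> P k t"
    using assms[of k] unit_cube_sets by (subst (asm) AE_restrict_space_iff) auto
  from AE_lebesgue_translation[OF this, of "- ofZ k"]
  show "AE t in lebesgue. t - ofZ k \<in> unit_cube \<longrightarrow> P k (t - ofZ k)" by simp
qed

text \<open>The norm bound is uniform in k, which lets it serve as the constant B in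
  \<open>nuclear_series_AE\<close>.\<close>

lemma memLp_phi:
  fixes x :: "real ^ 'n::finite \<Rightarrow> complex"
  assumes p: "1 \<le> p" and x: "memLp p lebesgue x"
  shows "memLp p (lebesgue_on unit_cube) (phi x k)"
    and "Lpnorm p (lebesgue_on unit_cube) (phi x k) \<le> Lpnorm p lebesgue x"
proof -
  have m: "phi x k \<in> borel_measurable lebesgue"
    unfolding phi_def
    using measurable_compose[OF measurable_lebesgue_translation memLpD(1)[OF x]] .
  have "has_bochner_integral lebesgue (\<lambda>t. norm (x t) powr p) (\<integral>t. norm (x t) powr p \<partial>lebesgue)"
    using memLpD(2)[OF x] by (simp add: has_bochner_integral_iff)
  from has_bochner_integral_lebesgue_translation[OF this, of "ofZ k"]
  have i: "integrable lebesgue (\<lambda>t. norm (phi x k t) powr p)"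
      and e: "(\<integral>t. norm (phi x k t) powr p \<partial>lebesgue) = (\<integral>t. norm (x t) powr p \<partial>lebesgue)"
    by (simp_all add: has_bochner_integral_iff phi_def)
  have i': "integrable lebesgue (\<lambda>t. indicator unit_cube t *\<^sub>R norm (phi x k t) powr p)"
    by (rule integrable_mult_indicator[OF unit_cube_sets i])
  show "memLp p (lebesgue_on unit_cube) (phi x k)"
    unfolding memLp_def
  proof
    show "phi x k \<in> borel_measurable (lebesgue_on unit_cube)"
      using m by (rule measurable_restrict_space1)
    show "integrable (lebesgue_on unit_cube) (\<lambda>t. norm (phi x k t) powr p)"
      using i' unit_cube_sets by (subst integrable_restrict_space) auto
  qed
  have "(\<integral>t. norm (phi x k t) powr p \<partial>lebesgue_on unit_cube)
      = (\<integral>t. indicator unit_cube t *\<^sub>R norm (phi x k t) powr p \<partial>lebesgue)"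
    using unit_cube_sets by (subst integral_restrict_space) auto
  also have "\<dots> \<le> (\<integral>t. norm (phi x k t) powr p \<partial>lebesgue)"
    using i i' by (intro integral_mono) (auto split: split_indicator)
  finally show "Lpnorm p (lebesgue_on unit_cube) (phi x k) \<le> Lpnorm p lebesgue x"
    unfolding Lpnorm_def e using p by (intro powr_mono2) auto
qed

section \<open>The kernel\<close>

text \<open>One output cell, with m running over the input cells. The summability claim keeps the
  norm inside the integral over s: this is stronger than absolute convergence of the series for w t,
  and it is what later permits exchanging the sum with integration in s.\<close>

lemma (in finite_measure) nuclear_series_AE:
  fixes z :: "'i::countable \<Rightarrow> 'a \<Rightarrow> complex"
  assumes p: "1 \<le> p"
    and rep: "\<And>m. nuclear_rep p M (b m) (a m) (y m)"
    and sum: "(\<lambda>m. \<Sum>i. dual_norm p M (a m i) * Lpnorm p M (y m i)) summable_on UNIV"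
    and h: "\<And>m i x. memLp p M x \<Longrightarrow> integrable M (\<lambda>s. h m i s * x s) \<and>
          a m i x = (\<integral>s. h m i s * x s \<partial>M) \<and>
          (\<integral>s. norm (h m i s * x s) \<partial>M) \<le> 4 * dual_norm p M (a m i) * Lpnorm p M x"
    and z: "\<And>m. memLp p M (z m)" and zB: "\<And>m. Lpnorm p M (z m) \<le> B"
    and w: "memLp p M w" and w_sum: "Lp_has_sum p M (\<lambda>m. b m (z m)) w"
  shows "AE t in M. (\<lambda>(m, i). norm (y m i t) * (\<integral>s. norm (h m i s * z m s) \<partial>M)) summable_on UNIV \<and>
           w t = (\<Sum>\<^sub>\<infinity>(m, i). y m i t * (\<integral>s. h m i s * z m s \<partial>M))"
proof -
  define I where "I m i = (\<integral>s. norm (h m i s * z m s) \<partial>M)" for m i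
  define c where "c m i = (\<integral>s. h m i s * z m s \<partial>M)" for m i
  have I0: "0 \<le> I m i" for m i by (simp add: I_def)
  have cI: "norm (c m i) \<le> I m i" for m i
    unfolding c_def I_def by (rule integral_norm_bound)
  have ac: "a m i (z m) = c m i" for m i
    using h[OF z, of m i m] by (simp add: c_def)
  have y: "memLp p M (y m i)" and a: "dual_elem p M (a m i)" for m i
    using rep[of m] by (auto simp: nuclear_rep_def)
  define K where "K = measure M (space M) + 1"
  define d where "d m i = dual_norm p M (a m i) * Lpnorm p M (y m i)" for m i
  have d0: "0 \<le> d m i" for m i by (simp add: d_def dual_norm_nonneg[OF a])
  have dsum: "((\<lambda>i. d m i) has_sum (\<Sum>i. d m i)) UNIV" for m
    using rep[of m] d0 by (intro norm_summable_imp_has_sum summable_sums) (auto simp: nuclear_rep_def d_def)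
  have dsummable: "(\<lambda>(m, i). d m i) summable_on UNIV \<times> UNIV"
    by (rule summable_on_SigmaI[where g="\<lambda>m. \<Sum>i. d m i"]) (use dsum sum d0 in \<open>auto simp: d_def\<close>)
  \<comment> \<open>Integrating over t bounds the (m, i) term by 4 * B * K * \<open>d m i\<close>: 4
    and B from the estimate of \<open>I m i\<close>, K from the L_1 bound of
    \<open>y m i\<close>.\<close>
  have S1: "AE t in M. (\<lambda>(m, i). norm (y m i t) * I m i) summable_on UNIV"
  proof -
    let ?f = "\<lambda>(m, i) t. complex_of_real (I m i) * y m i t"
    have "AE t in M. (\<lambda>j. norm (?f j t)) summable_on UNIV"
    proof (rule AE_norm_summable_on(1))
      show "integrable M (?f j)" for j
        using memLp_integrable(1)[OF p y] by (cases j) auto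
      show "(\<lambda>j. \<integral>t. norm (?f j t) \<partial>M) summable_on UNIV"
      proof (rule summable_on_comparison_test)
        show "(\<lambda>j. 4 * B * K * (case j of (m, i) \<Rightarrow> d m i)) summable_on UNIV"
          using dsummable by (intro summable_on_cmult_right) simp
        fix j :: "'i \<times> nat"
        obtain m i where j: "j = (m, i)" by force
        have "(\<integral>t. norm (?f j t) \<partial>M) = I m i * (\<integral>t. norm (y m i t) \<partial>M)"
          using I0 by (simp add: j norm_mult)
        also have "\<dots> \<le> (4 * dual_norm p M (a m i) * Lpnorm p M (z m)) * (K * Lpnorm p M (y m i))"
          using h[OF z, of m i m] memLp_integrable(2)[OF p y, of m i] dual_norm_nonneg[OF a]
          by (intro mult_mono) (auto simp: I_def K_def)
        also have "\<dots> = (4 * K * d m i) * Lpnorm p M (z m)"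
          by (simp add: d_def)
        also have "\<dots> \<le> (4 * K * d m i) * B"
          using zB d0 by (intro mult_left_mono) (auto simp: K_def)
        finally show "(\<integral>t. norm (?f j t) \<partial>M) \<le> 4 * B * K * (case j of (m, i) \<Rightarrow> d m i)"
          by (simp add: j mult_ac)
      qed auto
    qed
    then show ?thesis
      by eventually_elim (simp add: case_prod_beta' norm_mult I0 mult.commute)
  qed
  define g where "g t j = (case j of (m, i) \<Rightarrow> y m i t * c m i)" for t j
  have gsum: "(\<lambda>j. norm (g t j)) summable_on UNIV"
    if "(\<lambda>(m, i). norm (y m i t) * I m i) summable_on UNIV" for t
    by (rule summable_on_comparison_test[OF that])
       (auto simp: g_def norm_mult intro!: mult_left_mono cI)
  \<comment> \<open>The hypotheses supply an iterated limit, in i for each m and then in m. Absolute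
    summability over pairs makes both stages converge pointwise and lets the iterated sum be merged
    into one.\<close>
  have slice: "(\<lambda>i. norm (g t (m, i))) summable_on UNIV" and
       row: "(\<lambda>m. norm (\<Sum>\<^sub>\<infinity>i. g t (m, i))) summable_on UNIV"
    if s: "(\<lambda>j. norm (g t j)) summable_on UNIV" for t m
  proof -
    have s': "(\<lambda>(m, i). norm (g t (m, i))) summable_on UNIV \<times> UNIV"
      using s by (simp add: case_prod_beta')
    show sl: "(\<lambda>i. norm (g t (m, i))) summable_on UNIV" for m
      using summable_on_SigmaD1[of "\<lambda>m i. norm (g t (m, i))" UNIV "\<lambda>_. UNIV" m] s' by simp
    have "(\<lambda>m. \<Sum>\<^sub>\<infinity>i. norm (g t (m, i))) summable_on UNIV"
      using summable_on_Sigma_banach[OF s'] by simp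
    then show "(\<lambda>m. norm (\<Sum>\<^sub>\<infinity>i. g t (m, i))) summable_on UNIV"
      by (rule summable_on_comparison_test) (auto intro: norm_infsum_bound sl)
  qed
  have bm: "memLp p M (b m (z m))" for m
    using rep[of m] z by (auto simp: nuclear_rep_def)
  have S2: "AE t in M. b m (z m) t = (\<Sum>\<^sub>\<infinity>i. g t (m, i))" for m
  proof (rule tendsto_Lpnorm_imp_AE_eq[OF p bm])
    show "memLp p M (\<lambda>t. \<Sum>i<N. a m i (z m) * y m i t)" for N
      by (intro memLp_sum memLp_scale p y)
    show "(\<lambda>N. Lpnorm p M (\<lambda>t. b m (z m) t - (\<Sum>i<N. a m i (z m) * y m i t))) \<longlonglongrightarrow> 0"
      using rep[of m] z by (auto simp: nuclear_rep_def Lp_sums_def)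
    show "AE t in M. (\<lambda>N. \<Sum>i<N. a m i (z m) * y m i t) \<longlonglongrightarrow> (\<Sum>\<^sub>\<infinity>i. g t (m, i))"
      using S1
    proof eventually_elim
      case (elim t)
      have "((\<lambda>i. g t (m, i)) has_sum (\<Sum>\<^sub>\<infinity>i. g t (m, i))) UNIV"
        by (rule has_sum_infsum[OF abs_summable_summable[OF slice[OF gsum[OF elim]]]])
      then have "(\<lambda>i. g t (m, i)) sums (\<Sum>\<^sub>\<infinity>i. g t (m, i))" by (rule has_sum_imp_sums)
      then show ?case by (simp add: sums_def g_def ac mult.commute)
    qed
  qed
  \<comment> \<open>The outer sum converges to w in norm along finite sets of m; along
    \<open>exhaustion\<close> it becomes a sequence, whose pointwise limit is known from the row
    sums.\<close>
  have S3: "AE t in M. w t = (\<Sum>\<^sub>\<infinity>j. g t j)"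
  proof (rule tendsto_Lpnorm_imp_AE_eq[OF p w])
    show "memLp p M (\<lambda>t. \<Sum>m\<in>exhaustion N. b m (z m) t)" for N
      by (intro memLp_sum p bm)
    show "(\<lambda>N. Lpnorm p M (\<lambda>t. w t - (\<Sum>m\<in>exhaustion N. b m (z m) t))) \<longlonglongrightarrow> 0"
      using filterlim_compose[OF w_sum[unfolded Lp_has_sum_def] filterlim_exhaustion] .
    have "AE t in M. \<forall>m. b m (z m) t = (\<Sum>\<^sub>\<infinity>i. g t (m, i))"
      using S2 by (simp add: AE_all_countable)
    then show "AE t in M. (\<lambda>N. \<Sum>m\<in>exhaustion N. b m (z m) t) \<longlonglongrightarrow> (\<Sum>\<^sub>\<infinity>j. g t j)"
      using S1
    proof eventually_elim
      case (elim t)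
      note s = gsum[OF elim(2)]
      have "(\<Sum>\<^sub>\<infinity>m. \<Sum>\<^sub>\<infinity>i. g t (m, i)) = (\<Sum>\<^sub>\<infinity>j. g t j)"
        using infsum_Sigma_banach[of "g t" UNIV "\<lambda>_. UNIV"] abs_summable_summable[OF s] by simp
      then show ?case using infsum_exhaustion[OF row[OF s]] elim(1) by simp
    qed
  qed
  show ?thesis
    using S1 S3 by eventually_elim (simp add: g_def[abs_def] c_def I_def)
qed

section \<open>Choice of the representations and assembly of the kernel\<close>

lemma nuclear_rep_almost_optimal:
  assumes "nuclear p M b" "nuclear_norm p M b < r"
  shows "\<exists>a y. nuclear_rep p M b a y \<and> (\<Sum>i. dual_norm p M (a i) * Lpnorm p M (y i)) < r"
proof -
  let ?S = "{(\<Sum>i. dual_norm p M (a i) * Lpnorm p M (y i)) | a y. nuclear_rep p M b a y}"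
  have "?S \<noteq> {}" using assms(1) by (auto simp: nuclear_def)
  from cInf_lessD[OF this assms(2)[unfolded nuclear_norm_def]] show ?thesis by auto
qed

lemma choice_pair:
  assumes "\<And>k m. \<exists>a y. R k m a y"
  shows "\<exists>a y. \<forall>k m. R k m (a k m) (y k m)"
  using assms by metis

lemma choice_triple:
  assumes "\<And>k m i. \<exists>h. R k m i h"
  shows "\<exists>h. \<forall>k m i. R k m i (h k m i)"
  using assms by metis

lemma summable_on_half_powers: "(\<lambda>m :: 'i::countable. (1 / 2 :: real) ^ to_nat m) summable_on UNIV"
proof -
  have "(\<lambda>n. (1 / 2 :: real) ^ n) summable_on UNIV"
    by (rule norm_summable_imp_summable_on) (simp add: summable_geometric)
  then have "(\<lambda>n. (1 / 2 :: real) ^ n) summable_on range (to_nat :: 'i \<Rightarrow> nat)"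
    by (rule summable_on_subset_banach) auto
  then show ?thesis by (simp add: summable_on_reindex o_def)
qed

lemma l1g_summable_on:
  assumes "weight g" "l1g g \<beta>"
  shows "(\<lambda>m. norm (\<beta> m)) summable_on UNIV"
proof (rule summable_on_comparison_test[OF assms(2)[unfolded l1g_def]])
  show "norm (\<beta> m) \<le> g m * norm (\<beta> m)" for m
    using assms(1) mult_right_mono[of 1 "g m" "norm (\<beta> m)"] by (simp add: weight_def)
qed auto

theorem mainTheorem3:
  fixes p :: real
    and g :: "int ^ 'n::finite \<Rightarrow> real"
    and A :: "(real ^ 'n \<Rightarrow> complex) \<Rightarrow> (real ^ 'n \<Rightarrow> complex)"
  assumes "1 \<le> p"
    and "weight g"
    and "S1g p g A"
  shows "\<exists>n :: ((real ^ 'n) \<times> (real ^ 'n)) \<Rightarrow> complex.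
           n \<in> borel_measurable (lebesgue \<Otimes>\<^sub>M lebesgue) \<and>
           (\<forall>x. memLp p lebesgue x \<longrightarrow>
              (AE t in lebesgue.
                 integrable lebesgue (\<lambda>s. n (t, s) * x s) \<and>
                 A x t = (\<integral>s. n (t, s) * x s \<partial>lebesgue)))"
proof -
  note p = \<open>1 \<le> p\<close>
  let ?Q = "lebesgue_on (unit_cube :: (real ^ 'n) set)"
  interpret Q: finite_measure ?Q by (rule finite_measure_unit_cube)
  obtain b \<beta> where \<beta>: "\<And>m. \<beta> m \<ge> 0" "l1g g \<beta>"
    and nuc: "\<And>k m. nuclear p ?Q (b k m)" "\<And>k m. nuclear_norm p ?Q (b k m) \<le> \<beta> m"
    and A_sum: "\<And>x k. memLp p lebesgue x \<Longrightarrow>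
        Lp_has_sum p ?Q (\<lambda>m. b k m (phi x (k - m))) (phi (A x) k)"
    and A_mem: "\<And>x. memLp p lebesgue x \<Longrightarrow> memLp p lebesgue (A x)"
    using assms(3) unfolding S1g_def bounded_Lp_operator_def by blast
  \<comment> \<open>The nuclear norm is an infimum that need not be attained. The strictly positive,
    summable slack leaves room for a representation below \<open>\<gamma> m\<close>, with a bound
    independent of k.\<close>
  define \<gamma> where "\<gamma> m = \<beta> m + (1 / 2) ^ to_nat m" for m
  have \<gamma>: "\<gamma> summable_on UNIV"
    unfolding \<gamma>_def using l1g_summable_on[OF assms(2) \<beta>(2)] \<beta>(1)
    by (intro summable_on_add summable_on_half_powers) simp
  have "\<exists>a y. nuclear_rep p ?Q (b k m) a y \<and> (\<Sum>i. dual_norm p ?Q (a i) * Lpnorm p ?Q (y i)) < \<gamma> m" for k m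
    using nuc(2)[of k m] by (intro nuclear_rep_almost_optimal nuc(1)) (simp add: \<gamma>_def le_less_trans)
  then have "\<exists>a y. \<forall>k m. nuclear_rep p ?Q (b k m) (a k m) (y k m) \<and>
      (\<Sum>i. dual_norm p ?Q (a k m i) * Lpnorm p ?Q (y k m i)) < \<gamma> m"
    by (rule choice_pair)
  then obtain a y where rep: "\<And>k m. nuclear_rep p ?Q (b k m) (a k m) (y k m)"
    and rep_le: "\<And>k m. (\<Sum>i. dual_norm p ?Q (a k m i) * Lpnorm p ?Q (y k m i)) < \<gamma> m"
    by blast
  have dual: "dual_elem p ?Q (a k m i)" and yLp: "memLp p ?Q (y k m i)" for k m i
    using rep[of k m] by (auto simp: nuclear_rep_def)
  have "\<exists>h. \<forall>k m i. h k m i \<in> borel_measurable ?Q \<and> (\<forall>x. memLp p ?Q x \<longrightarrow>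
          integrable ?Q (\<lambda>s. h k m i s * x s) \<and> a k m i x = (\<integral>s. h k m i s * x s \<partial>?Q) \<and>
          (\<integral>s. norm (h k m i s * x s) \<partial>?Q) \<le> 4 * dual_norm p ?Q (a k m i) * Lpnorm p ?Q x)"
    by (rule choice_triple) (use Q.Lp_dual_representation[OF p dual] in blast)
  then obtain h where hm: "\<And>k m i. h k m i \<in> borel_measurable ?Q"
    and h: "\<And>k m i x. memLp p ?Q x \<Longrightarrow> integrable ?Q (\<lambda>s. h k m i s * x s) \<and>
          a k m i x = (\<integral>s. h k m i s * x s \<partial>?Q) \<and>
          (\<integral>s. norm (h k m i s * x s) \<partial>?Q) \<le> 4 * dual_norm p ?Q (a k m i) * Lpnorm p ?Q x"
    by blast
  have rep_summable: "(\<lambda>m. \<Sum>i. dual_norm p ?Q (a k m i) * Lpnorm p ?Q (y k m i)) summable_on UNIV" for k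
  proof (rule summable_on_comparison_test[OF \<gamma>])
    show "0 \<le> (\<Sum>i. dual_norm p ?Q (a k m i) * Lpnorm p ?Q (y k m i))" for m
      using rep[of k m] by (intro suminf_nonneg) (auto simp: nuclear_rep_def dual_norm_nonneg)
  qed (use rep_le in \<open>auto intro: less_imp_le\<close>)

  \<comment> \<open>The operator \<open>b k m\<close> reads coordinate k - m and writes coordinate
    k, so its output vectors sit on cell k and its densities on cell k - m.\<close>
  define Y where "Y = (\<lambda>(k, m, i). cell k (y k m i))"
  define H where "H = (\<lambda>(k, m, i). cell (k - m) (h k m i))"
  have Ym [measurable]: "Y j \<in> borel_measurable lebesgue" for j
    using memLpD(1)[OF yLp] by (auto simp: Y_def split: prod.split intro!: borel_measurable_cell)
  have Hm [measurable]: "H j \<in> borel_measurable lebesgue" for j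
    using hm by (auto simp: H_def split: prod.split intro!: borel_measurable_cell)
  \<comment> \<open>All cells enter one series, so no case distinction on the cells of t and s is
    needed and measurability is inherited from the terms.\<close>
  define n where "n = (\<lambda>(t, s). lim (\<lambda>N. \<Sum>j\<in>exhaustion N. Y j t * H j s))"
  have "n \<in> borel_measurable (lebesgue \<Otimes>\<^sub>M lebesgue)"
    unfolding n_def by measurable
  moreover have "AE t in lebesgue. integrable lebesgue (\<lambda>s. n (t, s) * x s) \<and>
                 A x t = (\<integral>s. n (t, s) * x s \<partial>lebesgue)" if x: "memLp p lebesgue x" for x
  proof -
    define I where "I = (\<lambda>(k, m, i). \<integral>s. norm (h k m i s * phi x (k - m) s) \<partial>?Q)"
    define c where "c = (\<lambda>(k, m, i). \<integral>s. h k m i s * phi x (k - m) s \<partial>?Q)"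
    \<comment> \<open>The exceptional t arise here, after x is fixed; the definition of n involves
      no x.\<close>
    define P where "P k t \<longleftrightarrow> (\<lambda>(m, i). norm (y k m i t) * I (k, m, i)) summable_on UNIV \<and>
           phi (A x) k t = (\<Sum>\<^sub>\<infinity>(m, i). y k m i t * c (k, m, i))" for k t
    have "AE t in ?Q. P k t" for k
      using Q.nuclear_series_AE[OF p rep[of k] rep_summable[of k] h memLp_phi(1)[OF p x]
          memLp_phi(2)[OF p x] memLp_phi(1)[OF p A_mem[OF x]] A_sum[OF x]]
      by (simp add: P_def I_def c_def)
    from AE_lebesgue_cells[of P, OF this] show ?thesis
    proof eventually_elim
      case (elim t)
      obtain k where k: "t - ofZ k \<in> unit_cube" using unit_cube_cell_exists by blast
      have Yk: "Y (k', m, i) t = (if k' = k then y k m i (t - ofZ k) else 0)" for k' m i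
      proof (cases "k' = k")
        case False
        then have "t - ofZ k' \<notin> unit_cube" using unit_cube_cell_unique[OF _ k] by blast
        then show ?thesis using False by (simp add: Y_def cell_def)
      qed (simp add: Y_def cell_def k)
      have Yq: "Y (k, q) t = y k (fst q) (snd q) (t - ofZ k)" for q
        by (cases q) (simp add: Yk)
      have S: "(\<lambda>q. norm (Y (k, q) t) * I (k, q)) summable_on UNIV"
        and Ax: "A x t = (\<Sum>\<^sub>\<infinity>q. Y (k, q) t * c (k, q))"
        using elim[rule_format, OF k] by (auto simp: P_def Yq case_prod_beta' phi_def)
      \<comment> \<open>Since t lies in exactly one cell, every triple with another first index
        contributes 0. The sums over pairs (m, i) thus extend to all triples, the index set along
        which n is formed.\<close>
      have inj: "inj (Pair k)" for k :: "int ^ 'n" by (auto intro: injI)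
      have "(\<lambda>j. norm (Y j t) * I j) summable_on range (Pair k)"
        using S by (simp add: summable_on_reindex[OF inj] o_def)
      also have "?this \<longleftrightarrow> (\<lambda>j. norm (Y j t) * I j) summable_on UNIV"
        by (rule summable_on_cong_neutral) (auto simp: Yk image_iff)
      finally have YI: "(\<lambda>j. norm (Y j t) * I j) summable_on UNIV" .
      have "A x t = (\<Sum>\<^sub>\<infinity>j\<in>range (Pair k). Y j t * c j)"
        using Ax by (simp add: infsum_reindex[OF inj] o_def)
      also have "\<dots> = (\<Sum>\<^sub>\<infinity>j. Y j t * c j)"
        by (rule infsum_cong_neutral) (auto simp: Yk image_iff)
      finally have Axt: "A x t = (\<Sum>\<^sub>\<infinity>j. Y j t * c j)" .
      have Hx: "has_bochner_integral lebesgue (\<lambda>s. H j s * x s) (c j)"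
           "has_bochner_integral lebesgue (\<lambda>s. norm (H j s * x s)) (I j)" for j
      proof -
        obtain k m i where j: "j = (k, m, i)" by (cases j)
        have int: "integrable ?Q (\<lambda>s. h k m i s * phi x (k - m) s)"
          using h[OF memLp_phi(1)[OF p x]] by blast
        have "(\<lambda>s. H j s * x s) = cell (k - m) (\<lambda>s. h k m i s * phi x (k - m) s)"
          by (auto simp: j H_def cell_def phi_def)
        then show "has_bochner_integral lebesgue (\<lambda>s. H j s * x s) (c j)"
          using has_bochner_integral_cell[OF int] by (simp add: j c_def)
        have "(\<lambda>s. norm (H j s * x s)) = cell (k - m) (\<lambda>s. norm (h k m i s * phi x (k - m) s))"
          by (auto simp: j H_def cell_def phi_def)
        then show "has_bochner_integral lebesgue (\<lambda>s. norm (H j s * x s)) (I j)"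
          using has_bochner_integral_cell[OF integrable_norm[OF int]] by (simp add: j I_def)
      qed
      define f where "f j s = Y j t * (H j s * x s)" for j s
      have fint: "integrable lebesgue (f j)" for j
        unfolding f_def using Hx(1)[of j] by (intro integrable_mult_right) (auto simp: has_bochner_integral_iff)
      have fI: "(\<integral>s. norm (f j s) \<partial>lebesgue) = norm (Y j t) * I j" for j
        unfolding f_def norm_mult[of "Y j t"] using Hx(2)[of j] by (simp add: has_bochner_integral_iff)
      have fc: "(\<integral>s. f j s \<partial>lebesgue) = Y j t * c j" for j
        unfolding f_def using Hx(1)[of j] by (simp add: has_bochner_integral_iff)
      have fsum: "(\<lambda>j. \<integral>s. norm (f j s) \<partial>lebesgue) summable_on UNIV"
        using YI by (simp add: fI)
      have "has_bochner_integral lebesgue (\<lambda>s. lim (\<lambda>N. \<Sum>j\<in>exhaustion N. f j s)) (A x t)"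
        using has_bochner_integral_lim_exhaustion[OF fint fsum] by (simp add: fc Axt)
      \<comment> \<open>Only almost everywhere: lim is a junk value where the partial sums diverge.\<close>
      moreover have "AE s in lebesgue. lim (\<lambda>N. \<Sum>j\<in>exhaustion N. f j s) = n (t, s) * x s"
        using AE_norm_summable_on(1)[OF fint fsum]
      proof eventually_elim
        case (elim s)
        have f_eq: "(\<Sum>j\<in>exhaustion N. f j s) = (\<Sum>j\<in>exhaustion N. Y j t * H j s) * x s" for N
          by (simp add: f_def sum_distrib_right mult.assoc)
        show ?case
        \<comment> \<open>Convergence of the series for f allows a division by x s only where it is
          nonzero. Where x s = 0 the kernel series may diverge, but every partial sum of f is 0 and
          so is n (t, s) * x s.\<close>
        proof (cases "x s = 0")
          case True
          then show ?thesis by (simp add: f_eq)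
        next
          case False
          have L: "(\<lambda>N. (\<Sum>j\<in>exhaustion N. Y j t * H j s) * x s) \<longlonglongrightarrow> (\<Sum>\<^sub>\<infinity>j. f j s)"
            using infsum_exhaustion[OF elim] by (simp add: f_eq)
          then have "(\<lambda>N. \<Sum>j\<in>exhaustion N. Y j t * H j s) \<longlonglongrightarrow> (\<Sum>\<^sub>\<infinity>j. f j s) / x s"
            using tendsto_divide[OF L tendsto_const, of "x s"] False by simp
          then have "n (t, s) = (\<Sum>\<^sub>\<infinity>j. f j s) / x s" by (simp add: n_def limI)
          then show ?thesis using L False by (simp add: f_eq limI)
        qed
      qed
      moreover have "(\<lambda>s. n (t, s) * x s) \<in> borel_measurable lebesgue"
        unfolding n_def prod.case
        by (intro borel_measurable_times borel_measurable_lim_metric borel_measurable_sum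
            borel_measurable_const Hm memLpD(1)[OF x])
      ultimately have "has_bochner_integral lebesgue (\<lambda>s. n (t, s) * x s) (A x t)"
        by (subst has_bochner_integral_cong_AE[symmetric]) (auto simp: has_bochner_integral_iff)
      then show ?case by (simp add: has_bochner_integral_iff)
    qed
  qed
  ultimately show ?thesis by blast
qed

end
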